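(* Let $K$ be a field of characteristic zero, let $G$ be a finite group with a chain of normal subgroups $1 = G_0 \triangleleft G_1 \triangleleft \cdots \triangleleft G_d = G$, let $H \triangleleft G$ be a normal subgroup, and put $H_i = H\cap G_i$. Assume that all $H_i$ are normal in $G$, and that an ascending transversal has been fixed for which the associated 2-cocycle $h : G/H\times G/H \to H$ is filtered. Let $N$ be an irreducible $FKH$-fragment of essential length $d$ (with zero body). Then the induced fragment $M = K[G/H]\otimes_K N$ decomposes into a fragment direct sum of $[G:H]$ irreducible $FKH$-fragments of essential length $d$.
   Context: **Filtrations.** $FKG$ is given by $F_nKG = KG_n$ for $0\le n\le d$ and $F_nKG=KG$ for $n\geq d$; $FKH$ by $F_nKH = KH_n$ for $0\le n\le d$ and $F_nKH = KH$ for $n\ge d$. So $F_0 = K$. **Fragments.** Let $FR$ be a positive filtration $F_0R\subset F_1R\subset\cdots$ on a ring $R$, with subring $S=F_0R\ni 1$. A (left) $FR$-fragment $M$ is an $S$-module with a descending chain of subgroups $M=M_0\supseteq M_1\supseteq\cdots$ such that: (f1) for every $i$ there is an $S$-module $M_i^*$ with $M\supseteq M_i^*\supseteq M_i$ and an operation $\varphi_i:F_iR\times M_i^*\to M$, $(\lambda,m)\mapsto\lambda m$, additive in each variable, with $1m=m$; (f2) for $j\le i$, $F_jR\cdot M_i\subset M_{i-j}$, and for $\lambda\in F_jR$, $m\in M_i$ the elements $\lambda m$ computed by $\varphi_i$ and by $\varphi_j$ coincide; (f3) whenever $F_iR\,F_jR\subset F_\mu R$ (with $j \le \mu$), $F_jR\,M_\mu\subset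 M_i^*\cap M_{\mu-j}$, and $\lambda(\delta m)=(\lambda\delta)m$ for $\lambda\in F_iR,\delta\in F_jR,m\in M_\mu$. The body is $B(M)=\bigcap_i M_i$. $M$ has essential length $e$ if $M_e\ne B(M)$ but $M_{e+1}=B(M)$. A subfragment of $M$ is an $S$-submodule $N$ with a chain $N=N_0\supseteq N_1\supseteq\cdots$, $N_i\subseteq M_i$, such that the actions of $F_iR$ on $M_i$ induce actions on $N_i$ making $N$ an $FR$-fragment. A subfragment $N$ is trivial if one of the following holds: ($T_1$) there is $k\ge0$ with $N_k=B(N)$ but $M_k\ne B(M)$; ($T_2$) there is $k\ge 0$ with $N_k=0$ but $M_k\neq0$; ($T_3$) there is a monotone increasing map $\alpha:\mathbb N\to\mathbb N$ with $N_k=M_{\alpha(k)}$ and $\alpha(k)-l\ge\alpha(k-l)$ for all $l\le k$. $M$ is irreducible if all its subfragments are trivial. **Fragment direct sums.** Sums of fragments are formed levelwise: $(E+F)_i=E_i+F_i$. A sum $E+F$ is called (fragment) direct if for some $i$ not exceeding the essential lengths of $E$ and $F$ one has $E_i\cap F_i=0$ (for several summands: for some $i$ not exceeding any of the essential lengths, the sum of the $i$-th terms is direct). An $FKG$-fragment is regarded as an $FKH$-fragment by restricting the actions. **Transversal and cocycle.** $G_i/H_i\cong G_iH/H$ is regarded as a subgroup of $G/H$. An ascending transversal is a chain $1\in T_1\subseteq T_2\subseteq\cdots\subseteq T_d=T$ with $T_i\subset G_i$ a set of representatives of the cosets $gH_i$ in $G_i$. Let $\sigma:G/H\to T$ be the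 corresponding section (so every $g\in G$ is $\sigma(\bar g)h$ for a unique $h\in H$), and define $h(-,-):G/H\times G/H\to H$ by $\sigma(\bar g_1)\sigma(\bar g_2)=\sigma(\overline{g_1g_2})\,h(\bar g_1,\bar g_2)$. The cocycle is filtered if $h(\bar a,\bar g)\in H_i$ for every $i$, every $\bar a\in G_i/H_i$ and every $g\in G$. **Induced fragment.** For an $FKH$-fragment $N$, $N^G=M=K[G/H]\otimes_KN=\bigoplus_{\bar g\in G/H}K\bar g\otimes N$, with $M_j=K[G/H]\otimes_KN_j$. For $g_1=t_1h_1\in G_j$ with $t_1=\sigma(\bar g_1)$, $h_1\in H_j$, and $t=\sigma(\bar g)$, $n\in N_j$, the action is $g_1\cdot(\bar g\otimes n)=\overline{g_1g}\otimes h(\bar g_1,\bar g)\,t^{-1}h_1t\,n$, extended $K$-bilinearly. *)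

theory Defs
  imports "HOL-Algebra.Subrings"
begin

section \<open>Fragments over a filtered ring\<close>

text \<open>
  As for modules in HOL-Algebra, the additive group of a fragment is carried by the fields of
  \<open>ring\<close>; the fields \<open>mult\<close> and \<open>one\<close> are not used. The field
  \<open>act M i\<close> is the operation \<open>\<phi>\<^sub>i\<close>, meaningful on \<open>F i \<times> star M i\<close> only.
\<close>

record ('r, 'm) fragment = "'m ring" +
  lev  :: "nat \<Rightarrow> 'm set"
  star :: "nat \<Rightarrow> 'm set"
  act  :: "nat \<Rightarrow> 'r \<Rightarrow> 'm \<Rightarrow> 'm"

locale filtered_ring = ring R for R (structure) +
  fixes F :: "nat \<Rightarrow> 'a set"
  assumes F_additive: "additive_subgroup (F i) R"
    and F_mono: "F i \<subseteq> F (Suc i)"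
    and F_mult: "\<lbrakk> a \<in> F i; b \<in> F j \<rbrakk> \<Longrightarrow> a \<otimes> b \<in> F (i + j)"
    and F_zero: "subring (F 0) R"

text \<open>
  The module structure of \<open>M\<close> over \<open>S = F 0\<close> is the operation \<open>act M 0\<close>, which is defined on all
  of \<open>M\<close> because \<open>star M 0 = M\<close>; its module laws are the instances of
  (f1) and (f3) at index \<open>0\<close>. In (f3) the inner product \<open>\<delta> m\<close> is computed by \<open>\<phi>\<^sub>j\<close>, which is
  possible since \<open>j \<le> \<mu>\<close>.
\<close>

locale fragment = filtered_ring R F + M: abelian_group M
  for R :: "('a, 'b) ring_scheme" (structure) and F and M :: "('a, 'm) fragment" +
  assumes lev_zero: "lev M 0 = carrier M"
    and lev_subgroup: "additive_subgroup (lev M i) M"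
    and lev_antimono: "lev M (Suc i) \<subseteq> lev M i"
    and star_subgroup: "additive_subgroup (star M i) M"
    and star_smult: "\<lbrakk> a \<in> F 0; m \<in> star M i \<rbrakk> \<Longrightarrow> act M 0 a m \<in> star M i"
    and lev_star: "lev M i \<subseteq> star M i"
    and act_closed: "\<lbrakk> a \<in> F i; m \<in> star M i \<rbrakk> \<Longrightarrow> act M i a m \<in> carrier M"
    and act_add_left: "\<lbrakk> a \<in> F i; b \<in> F i; m \<in> star M i \<rbrakk>
          \<Longrightarrow> act M i (a \<oplus> b) m = act M i a m \<oplus>\<^bsub>M\<^esub> act M i b m"
    and act_add_right: "\<lbrakk> a \<in> F i; m \<in> star M i; n \<in> star M i \<rbrakk>
          \<Longrightarrow> act M i a (m \<oplus>\<^bsub>M\<^esub> n) = act M i a m \<oplus>\<^bsub>M\<^esub> act M i a n"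
    and act_one: "m \<in> star M i \<Longrightarrow> act M i \<one> m = m"
    and f2_lev: "\<lbrakk> j \<le> i; a \<in> F j; m \<in> lev M i \<rbrakk> \<Longrightarrow> act M j a m \<in> lev M (i - j)"
    and f2_coincide: "\<lbrakk> j \<le> i; a \<in> F j; m \<in> lev M i \<rbrakk> \<Longrightarrow> act M i a m = act M j a m"
    and f3_closed: "\<lbrakk> \<And>a b. \<lbrakk> a \<in> F i; b \<in> F j \<rbrakk> \<Longrightarrow> a \<otimes> b \<in> F \<mu>; j \<le> \<mu>;
          b \<in> F j; m \<in> lev M \<mu> \<rbrakk> \<Longrightarrow> act M j b m \<in> star M i \<inter> lev M (\<mu> - j)"
    and f3_assoc: "\<lbrakk> \<And>a b. \<lbrakk> a \<in> F i; b \<in> F j \<rbrakk> \<Longrightarrow> a \<otimes> b \<in> F \<mu>; j \<le> \<mu>;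
          a \<in> F i; b \<in> F j; m \<in> lev M \<mu> \<rbrakk>
          \<Longrightarrow> act M i a (act M j b m) = act M \<mu> (a \<otimes> b) m"

definition body :: "('r, 'm) fragment \<Rightarrow> 'm set" where
  "body M = (\<Inter>i. lev M i)"

definition essential_length :: "('r, 'm) fragment \<Rightarrow> nat \<Rightarrow> bool" where
  "essential_length M e \<longleftrightarrow> lev M e \<noteq> body M \<and> lev M (Suc e) = body M"

text \<open>
  Only the actions on the levels of \<open>N\<close> are required to be those of \<open>M\<close>. On the part of
  \<open>star N i\<close> that (f3) needs, namely the products \<open>F j \<cdot> lev N \<mu>\<close>, agreement with
  \<open>act M i\<close> is then forced by (f3).
\<close>

definition subfragment ::
  "('r, 'x) ring_scheme \<Rightarrow> (nat \<Rightarrow> 'r set) \<Rightarrow> ('r, 'm) fragment \<Rightarrow> ('r, 'm) fragment \<Rightarrow> bool"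
  where
  "subfragment R F N M \<longleftrightarrow>
     fragment R F M \<and> fragment R F N \<and>
     \<zero>\<^bsub>N\<^esub> = \<zero>\<^bsub>M\<^esub> \<and>
     (\<forall>x \<in> carrier N. \<forall>y \<in> carrier N. x \<oplus>\<^bsub>N\<^esub> y = x \<oplus>\<^bsub>M\<^esub> y) \<and>
     (\<forall>i. lev N i \<subseteq> lev M i) \<and>
     (\<forall>i. \<forall>a \<in> F i. \<forall>n \<in> lev N i. act N i a n = act M i a n)"

text \<open>
  The inequality \<open>\<alpha>(k) - l \<ge> \<alpha>(k - l)\<close> of (T3) is one between integers; it is written additively
  to avoid truncated subtraction.
\<close>

definition trivial_subfragment :: "('r, 'm) fragment \<Rightarrow> ('r, 'm) fragment \<Rightarrow> bool" where
  "trivial_subfragment N M \<longleftrightarrow>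
     (\<exists>k. lev N k = body N \<and> lev M k \<noteq> body M) \<or>
     (\<exists>k. lev N k = {\<zero>\<^bsub>M\<^esub>} \<and> lev M k \<noteq> {\<zero>\<^bsub>M\<^esub>}) \<or>
     (\<exists>\<alpha> :: nat \<Rightarrow> nat. mono \<alpha> \<and> (\<forall>k. lev N k = lev M (\<alpha> k)) \<and>
        (\<forall>k. \<forall>l \<le> k. \<alpha> (k - l) + l \<le> \<alpha> k))"

definition irreducible_fragment ::
  "('r, 'x) ring_scheme \<Rightarrow> (nat \<Rightarrow> 'r set) \<Rightarrow> ('r, 'm) fragment \<Rightarrow> bool" where
  "irreducible_fragment R F M \<longleftrightarrow>
     fragment R F M \<and> (\<forall>N. subfragment R F N M \<longrightarrow> trivial_subfragment N M)"

text \<open>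
  \<open>M\<close> is the levelwise sum of the finite family \<open>E\<close>, and at some level not exceeding any of the
  essential lengths this sum is direct.
\<close>

definition fragment_direct_sum ::
  "('r, 'm) fragment \<Rightarrow> 'i set \<Rightarrow> ('i \<Rightarrow> ('r, 'm) fragment) \<Rightarrow> bool" where
  "fragment_direct_sum M I E \<longleftrightarrow>
     (\<forall>i. lev M i = {(\<Oplus>\<^bsub>M\<^esub>k \<in> I. x k) | x. \<forall>k \<in> I. x k \<in> lev (E k) i}) \<and>
     (\<exists>i. (\<forall>k \<in> I. \<exists>e. essential_length (E k) e \<and> i \<le> e) \<and>
        (\<forall>x. (\<forall>k \<in> I. x k \<in> lev (E k) i) \<and> (\<Oplus>\<^bsub>M\<^esub>k \<in> I. x k) = \<zero>\<^bsub>M\<^esub>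
           \<longrightarrow> (\<forall>k \<in> I. x k = \<zero>\<^bsub>M\<^esub>)))"


section \<open>Group algebras of finite groups\<close>

text \<open>
  Elements are functions on the whole type that vanish outside the group. Hence, for a subgroup
  \<open>H\<close> of \<open>G\<close>, the algebra of \<open>H\<close> is literally a subset of that of \<open>G\<close>, and a fragment over
  a filtration of the latter is regarded as one over the former without changing the record.
\<close>

definition group_algebra ::
  "('k, 'x) ring_scheme \<Rightarrow> ('g, 'y) monoid_scheme \<Rightarrow> ('g \<Rightarrow> 'k) ring" where
  "group_algebra K G =
     \<lparr> carrier = {a. (\<forall>g \<in> carrier G. a g \<in> carrier K) \<and> (\<forall>g. g \<notin> carrier G \<longrightarrow> a g = \<zero>\<^bsub>K\<^esub>)},
       mult = (\<lambda>a b g. if g \<in> carrier G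
                 then (\<Oplus>\<^bsub>K\<^esub>x \<in> carrier G. a x \<otimes>\<^bsub>K\<^esub> b (inv\<^bsub>G\<^esub> x \<otimes>\<^bsub>G\<^esub> g))
                 else \<zero>\<^bsub>K\<^esub>),
       one = (\<lambda>g. if g = \<one>\<^bsub>G\<^esub> then \<one>\<^bsub>K\<^esub> else \<zero>\<^bsub>K\<^esub>),
       zero = (\<lambda>g. \<zero>\<^bsub>K\<^esub>),
       add = (\<lambda>a b g. a g \<oplus>\<^bsub>K\<^esub> b g) \<rparr>"

text \<open>\<open>monomial K c g\<close> is the element \<open>c g\<close> of the group algebra.\<close>

definition monomial :: "('k, 'x) ring_scheme \<Rightarrow> 'k \<Rightarrow> 'g \<Rightarrow> 'g \<Rightarrow> 'k" where
  "monomial K c g = (\<lambda>x. if x = g then c else \<zero>\<^bsub>K\<^esub>)"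

definition group_filtration ::
  "('k, 'x) ring_scheme \<Rightarrow> ('g, 'y) monoid_scheme \<Rightarrow> nat \<Rightarrow> (nat \<Rightarrow> 'g set) \<Rightarrow> nat
     \<Rightarrow> ('g \<Rightarrow> 'k) set" where
  "group_filtration K G d Gs n =
     (if n \<le> d then carrier (group_algebra K (G\<lparr>carrier := Gs n\<rparr>))
      else carrier (group_algebra K G))"


section \<open>Transversals and the associated cocycle\<close>

text \<open>
  The chain \<open>1 \<in> T\<^sub>1 \<subseteq> \<dots> \<subseteq> T\<^sub>d\<close> is extended by \<open>T\<^sub>0\<close>. As \<open>G\<^sub>0 = 1\<close>, the conditions
  force \<open>T\<^sub>0 = {1}\<close>, so that \<open>T\<^sub>0 \<subseteq> T\<^sub>1\<close> says \<open>1 \<in> T\<^sub>1\<close>.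
\<close>

definition ascending_transversal ::
  "('g, 'y) monoid_scheme \<Rightarrow> 'g set \<Rightarrow> nat \<Rightarrow> (nat \<Rightarrow> 'g set) \<Rightarrow> (nat \<Rightarrow> 'g set) \<Rightarrow> bool" where
  "ascending_transversal G H d Gs T \<longleftrightarrow>
     \<one>\<^bsub>G\<^esub> \<in> T 0 \<and>
     (\<forall>i < d. T i \<subseteq> T (Suc i)) \<and>
     (\<forall>i \<le> d. T i \<subseteq> Gs i \<and>
        (\<forall>g \<in> Gs i. \<exists>!t. t \<in> T i \<and> t \<in> g <#\<^bsub>G\<^esub> (H \<inter> Gs i)))"

text \<open>Cosets are elements of \<open>carrier (G Mod H)\<close>; for normal \<open>H\<close> left and right cosets agree.\<close>

definition coset_section :: "'g set \<Rightarrow> 'g set \<Rightarrow> 'g" where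
  "coset_section T c = (THE t. t \<in> T \<and> t \<in> c)"

text \<open>The unique solution \<open>h\<close> of \<open>\<sigma>(c\<^sub>1) \<sigma>(c\<^sub>2) = \<sigma>(c\<^sub>1 c\<^sub>2) h(c\<^sub>1, c\<^sub>2)\<close>.\<close>

definition cocycle ::
  "('g, 'y) monoid_scheme \<Rightarrow> 'g set \<Rightarrow> 'g set \<Rightarrow> 'g set \<Rightarrow> 'g set \<Rightarrow> 'g" where
  "cocycle G H T c\<^sub>1 c\<^sub>2 =
     inv\<^bsub>G\<^esub> (coset_section T (c\<^sub>1 \<otimes>\<^bsub>G Mod H\<^esub> c\<^sub>2))
       \<otimes>\<^bsub>G\<^esub> (coset_section T c\<^sub>1 \<otimes>\<^bsub>G\<^esub> coset_section T c\<^sub>2)"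

definition filtered_cocycle ::
  "('g, 'y) monoid_scheme \<Rightarrow> 'g set \<Rightarrow> nat \<Rightarrow> (nat \<Rightarrow> 'g set) \<Rightarrow> 'g set \<Rightarrow> bool" where
  "filtered_cocycle G H d Gs T \<longleftrightarrow>
     (\<forall>i \<le> d. \<forall>a \<in> Gs i. \<forall>g \<in> carrier G.
        cocycle G H T (H #>\<^bsub>G\<^esub> a) (H #>\<^bsub>G\<^esub> g) \<in> H \<inter> Gs i)"


section \<open>The induced fragment\<close>

text \<open>
  \<open>K[G/H] \<otimes>\<^sub>K N\<close> is realised as the direct sum of copies \<open>K c \<otimes> N\<close> of \<open>N\<close> indexed by the cosets
  \<open>c\<close>: the function \<open>m\<close> stands for the sum of the \<open>c \<otimes> m c\<close>.
\<close>

definition coset_tensor ::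
  "('g, 'y) monoid_scheme \<Rightarrow> 'g set \<Rightarrow> ('r, 'm) fragment \<Rightarrow> ('g set \<Rightarrow> 'm) ring" where
  "coset_tensor G H N =
     \<lparr> carrier = carrier (G Mod H) \<rightarrow>\<^sub>E carrier N,
       mult = undefined, one = undefined,
       zero = (\<lambda>c \<in> carrier (G Mod H). \<zero>\<^bsub>N\<^esub>),
       add = (\<lambda>m m'. \<lambda>c \<in> carrier (G Mod H). m c \<oplus>\<^bsub>N\<^esub> m' c) \<rparr>"

definition pure_tensor ::
  "('g, 'y) monoid_scheme \<Rightarrow> 'g set \<Rightarrow> ('r, 'm) fragment \<Rightarrow> 'g set \<Rightarrow> 'm \<Rightarrow> 'g set \<Rightarrow> 'm" where
  "pure_tensor G H N c n = (\<lambda>c' \<in> carrier (G Mod H). if c' = c then n else \<zero>\<^bsub>N\<^esub>)"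

text \<open>
  The action of a group element \<open>g\<close> on \<open>c \<otimes> n\<close> by \<open>g c \<otimes> h(g, c) t\<^sup>-\<^sup>1 h\<^sub>1 t n\<close>, where
  \<open>g = t\<^sub>1 h\<^sub>1\<close> and \<open>t = \<sigma>(c)\<close>, is extended linearly; a scalar \<open>a g\<close> of \<open>K\<close> acts on \<open>N\<close>
  as the element \<open>(a g) 1\<close> of \<open>F 0 = K\<close>.
\<close>

definition induced_act ::
  "('k, 'x) ring_scheme \<Rightarrow> ('g, 'y) monoid_scheme \<Rightarrow> 'g set \<Rightarrow> nat \<Rightarrow> (nat \<Rightarrow> 'g set) \<Rightarrow> 'g set
     \<Rightarrow> ('g \<Rightarrow> 'k, 'm) fragment \<Rightarrow> nat \<Rightarrow> ('g \<Rightarrow> 'k) \<Rightarrow> ('g set \<Rightarrow> 'm) \<Rightarrow> ('g set \<Rightarrow> 'm)" where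
  "induced_act K G H d Gs T N j a m =
     (\<Oplus>\<^bsub>coset_tensor G H N\<^esub>g \<in> (if j \<le> d then Gs j else carrier G).
      \<Oplus>\<^bsub>coset_tensor G H N\<^esub>c \<in> carrier (G Mod H).
        let t\<^sub>1 = coset_section T (H #>\<^bsub>G\<^esub> g);
            h\<^sub>1 = inv\<^bsub>G\<^esub> t\<^sub>1 \<otimes>\<^bsub>G\<^esub> g;
            t = coset_section T c;
            u = cocycle G H T (H #>\<^bsub>G\<^esub> g) c \<otimes>\<^bsub>G\<^esub> (inv\<^bsub>G\<^esub> t \<otimes>\<^bsub>G\<^esub> h\<^sub>1 \<otimes>\<^bsub>G\<^esub> t)
        in pure_tensor G H N ((H #>\<^bsub>G\<^esub> g) \<otimes>\<^bsub>G Mod H\<^esub> c)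
             (act N 0 (monomial K (a g) \<one>\<^bsub>G\<^esub>) (act N j (monomial K \<one>\<^bsub>K\<^esub> u) (m c))))"

definition induced_fragment ::
  "('k, 'x) ring_scheme \<Rightarrow> ('g, 'y) monoid_scheme \<Rightarrow> 'g set \<Rightarrow> nat \<Rightarrow> (nat \<Rightarrow> 'g set) \<Rightarrow> 'g set
     \<Rightarrow> ('g \<Rightarrow> 'k, 'm) fragment \<Rightarrow> ('g \<Rightarrow> 'k, 'g set \<Rightarrow> 'm) fragment" where
  "induced_fragment K G H d Gs T N =
     ring.extend (coset_tensor G H N)
       (fragment.fields
          (\<lambda>j. carrier (G Mod H) \<rightarrow>\<^sub>E lev N j)
          (\<lambda>j. carrier (G Mod H) \<rightarrow>\<^sub>E star N j)
          (induced_act K G H d Gs T N))"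

end

theory Submission
  imports Defs
begin

text \<open>
  Restricted to \<open>KH\<close>, the induced fragment is the product over the cosets \<open>c\<close> of copies \<open>K c \<otimes> N\<close> of
  \<open>N\<close>, the copy at \<open>c\<close> being twisted by the automorphism of \<open>KH\<close> that extends conjugation by
  \<open>\<sigma>(c)\<close>: for \<open>h \<in> H\<close> the representative of \<open>h H\<close> is \<open>1\<close> and the cocycle disappears from
  \<open>h (c \<otimes> n) = c \<otimes> \<sigma>(c)\<^sup>-\<^sup>1 h \<sigma>(c) n\<close>. Since the \<open>H\<^sub>i\<close> are normal in \<open>G\<close>, the automorphism preserves the
  filtration, so twisting carries subfragments to subfragments with the same levels, and irreducibility
  and essential length pass from \<open>N\<close> to each copy. The sum of the copies is direct already at level \<open>0\<close>.
\<close>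


section \<open>Fragments\<close>

text \<open>The picture of \<open>M\<close> as a product of twisted copies of \<open>N\<close> is
  literally true only on the levels. \<open>induced_act\<close> lets c u act in two steps,
  \<open>act N 0\<close> for the scalar c after \<open>act N j\<close> for the group element u. On
  \<open>star N j\<close> beyond the levels, (f1) gives additivity but no linearity over
  \<open>K\<close>, so these two steps need not agree with \<open>act N j\<close> applied to the
  single element c u. The fragment axioms of \<open>M\<close> are therefore derived from copies of
  \<open>N\<close> whose action is recomputed as \<open>expanded_act\<close>. That this is again a
  fragment rests on (f3), which fixes the action on the products F_j N_mu. The summands, in
  contrast, keep the action of \<open>N\<close> itself: a subfragment has to share the action on
  levels only, so the irreducibility of \<open>N\<close> can be transferred directly. The filtered
  cocycle matters because \<open>induced_act\<close> sums over all of G_j even when the ring element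
  lies in \<open>KH\<close>. A term with coefficient zero vanishes only once its inner action is
  known to land in \<open>N\<close>, and this needs the acting element to lie in H_j also for g
  outside \<open>H\<close>.\<close>

lemma additive_map_finsum:
  assumes X: "abelian_group X" and Y: "abelian_group Y"
    and h: "\<And>x. x \<in> carrier X \<Longrightarrow> h x \<in> carrier Y" "h \<zero>\<^bsub>X\<^esub> = \<zero>\<^bsub>Y\<^esub>"
      "\<And>x y. x \<in> carrier X \<Longrightarrow> y \<in> carrier X \<Longrightarrow> h (x \<oplus>\<^bsub>X\<^esub> y) = h x \<oplus>\<^bsub>Y\<^esub> h y"
    and f: "f \<in> I \<rightarrow> carrier X"
  shows "h (finsum X f I) = finsum Y (\<lambda>i. h (f i)) I"
proof -
  interpret X: abelian_group X by fact
  interpret Y: abelian_group Y by fact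
  show ?thesis
    using f by (induction I rule: infinite_finite_induct) (auto simp: h Pi_def)
qed

text \<open>A criterion that mentions only \<open>carrier\<close>, \<open>zero\<close> and
  \<open>add\<close>, and no chosen inverses. It can be moved by simplification between records that
  share these fields, and checked componentwise in products.\<close>

lemma additive_subgroup_iff:
  fixes M (structure)
  assumes "abelian_group M"
  shows "additive_subgroup A M \<longleftrightarrow>
    A \<subseteq> carrier M \<and> \<zero> \<in> A \<and> (\<forall>x\<in>A. \<forall>y\<in>A. x \<oplus> y \<in> A) \<and> (\<forall>x\<in>A. \<exists>y\<in>A. y \<oplus> x = \<zero>)"
    (is "?L \<longleftrightarrow> ?R")
proof
  interpret abelian_group M by fact
  show ?R if ?L
  proof -
    interpret additive_subgroup A M by fact
    show ?thesis using a_subset a_closed zero_closed a_inv_closed l_neg by (meson subsetD)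
  qed
  show ?L if R: ?R
  proof (rule additive_subgroupI, rule add.subgroupI)
    show "\<ominus> x \<in> A" if "x \<in> A" for x
      using R that minus_equality by (metis subsetD)
  qed (use R in auto)
qed

context fragment
begin

lemma F_carrier: "a \<in> F i \<Longrightarrow> a \<in> carrier R"
  using additive_subgroup.a_Hcarr[OF F_additive] .

lemma F_le: "i \<le> j \<Longrightarrow> F i \<subseteq> F j"
  using lift_Suc_mono_le[of F, OF F_mono] .

lemma F_one: "\<one> \<in> F i"
  using F_le[of 0 i] subringE(3)[OF F_zero] by auto

lemma lev_le: "i \<le> j \<Longrightarrow> lev M j \<subseteq> lev M i"
  using lift_Suc_antimono_le[of "lev M", OF lev_antimono] .

lemma star_carrier: "m \<in> star M i \<Longrightarrow> m \<in> carrier M"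
  using additive_subgroup.a_Hcarr[OF star_subgroup] .

lemma lev_carrier: "m \<in> lev M i \<Longrightarrow> m \<in> carrier M"
  using additive_subgroup.a_Hcarr[OF lev_subgroup] .

lemma zero_in_lev: "\<zero>\<^bsub>M\<^esub> \<in> lev M i"
  using additive_subgroup.zero_closed[OF lev_subgroup] .

lemma zero_in_star: "\<zero>\<^bsub>M\<^esub> \<in> star M i"
  using additive_subgroup.zero_closed[OF star_subgroup] .

lemma carrier_star_zero: "m \<in> carrier M \<Longrightarrow> m \<in> star M 0"
  using lev_star[of 0] lev_zero by auto

lemma act_zero_left: "m \<in> star M i \<Longrightarrow> act M i \<zero> m = \<zero>\<^bsub>M\<^esub>"
proof -
  assume m: "m \<in> star M i"
  have z: "\<zero> \<in> F i" using additive_subgroup.zero_closed[OF F_additive] .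
  have "act M i \<zero> m \<oplus>\<^bsub>M\<^esub> act M i \<zero> m = act M i \<zero> m"
    using act_add_left[OF z z m] by simp
  then show ?thesis using act_closed[OF z m] by (simp add: M.add.r_cancel_one')
qed

lemma act_zero_right: "a \<in> F i \<Longrightarrow> act M i a \<zero>\<^bsub>M\<^esub> = \<zero>\<^bsub>M\<^esub>"
proof -
  assume a: "a \<in> F i"
  have "act M i a \<zero>\<^bsub>M\<^esub> \<oplus>\<^bsub>M\<^esub> act M i a \<zero>\<^bsub>M\<^esub> = act M i a \<zero>\<^bsub>M\<^esub>"
    using act_add_right[OF a zero_in_star zero_in_star] by simp
  then show ?thesis using act_closed[OF a zero_in_star] by (simp add: M.add.r_cancel_one')
qed

lemma finsum_in_F:
  assumes "a \<in> I \<rightarrow> F i"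
  shows "finsum R a I \<in> F i"
  using assms
proof (induction I rule: infinite_finite_induct)
  case (insert x I)
  then have "a \<in> I \<rightarrow> carrier R" "a x \<in> carrier R" using F_carrier by auto
  then show ?case using insert additive_subgroup.a_closed[OF F_additive] by simp
qed (use additive_subgroup.zero_closed[OF F_additive] in \<open>auto\<close>)

lemma act_finsum_left:
  assumes "finite I" "a \<in> I \<rightarrow> F i" "m \<in> star M i"
  shows "act M i (finsum R a I) m = finsum M (\<lambda>k. act M i (a k) m) I"
  using assms
proof (induction I)
  case empty
  then show ?case by (simp add: act_zero_left)
next
  case (insert x I)
  then have "a \<in> I \<rightarrow> carrier R" "a x \<in> carrier R" "finsum R a I \<in> F i"
    using F_carrier finsum_in_F[of a I] by auto
  then show ?case using insert act_closed by (simp add: act_add_left Pi_def)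
qed

end


text \<open>(f2) and (f3) speak of the action only on levels and on products F_j M_mu, so a new
  action has to agree with the old one there and nowhere else. On the rest of
  \<open>star M i\<close> it has to satisfy (f1) for itself.\<close>

lemma (in fragment) fragment_act_replace:
  assumes closed: "\<And>i a m. a \<in> F i \<Longrightarrow> m \<in> star M i \<Longrightarrow> act' i a m \<in> carrier M"
    and smult: "\<And>i a m. a \<in> F 0 \<Longrightarrow> m \<in> star M i \<Longrightarrow> act' 0 a m \<in> star M i"
    and add_left: "\<And>i a b m. a \<in> F i \<Longrightarrow> b \<in> F i \<Longrightarrow> m \<in> star M i \<Longrightarrow>
      act' i (a \<oplus> b) m = act' i a m \<oplus>\<^bsub>M\<^esub> act' i b m"
    and add_right: "\<And>i a m n. a \<in> F i \<Longrightarrow> m \<in> star M i \<Longrightarrow> n \<in> star M i \<Longrightarrow>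
      act' i a (m \<oplus>\<^bsub>M\<^esub> n) = act' i a m \<oplus>\<^bsub>M\<^esub> act' i a n"
    and one: "\<And>i m. m \<in> star M i \<Longrightarrow> act' i \<one> m = m"
    and on_lev: "\<And>i a m. a \<in> F i \<Longrightarrow> m \<in> lev M i \<Longrightarrow> act' i a m = act M i a m"
    and on_prod: "\<And>i j \<mu> a b m. (\<And>a b. a \<in> F i \<Longrightarrow> b \<in> F j \<Longrightarrow> a \<otimes> b \<in> F \<mu>) \<Longrightarrow> j \<le> \<mu> \<Longrightarrow>
      a \<in> F i \<Longrightarrow> b \<in> F j \<Longrightarrow> m \<in> lev M \<mu> \<Longrightarrow> act' i a (act M j b m) = act M i a (act M j b m)"
  shows "fragment R F (M\<lparr>act := act'\<rparr>)"
proof -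
  let ?M = "M\<lparr>act := act'\<rparr>"
  have ab: "abelian_group ?M"
    by (rule abelian_groupI) (use abelian_groupE[OF M.abelian_group_axioms] in auto)
  have eql: "act' j a m = act M j a m" if "a \<in> F j" "m \<in> lev M i" "j \<le> i" for i j a m
    using on_lev that lev_le by blast
  have eql': "act' i a m = act M i a m" if "a \<in> F j" "m \<in> lev M i" "j \<le> i" for i j a m
    using on_lev that F_le by blast
  show ?thesis
  proof (intro fragment.intro fragment_axioms.intro filtered_ring_axioms ab)
    fix i j \<mu> a b m
    assume FF: "\<And>a b. a \<in> F i \<Longrightarrow> b \<in> F j \<Longrightarrow> a \<otimes> b \<in> F \<mu>"
      and "j \<le> \<mu>" "b \<in> F j" "m \<in> lev ?M \<mu>"
    then have *: "j \<le> \<mu>" "b \<in> F j" "m \<in> lev M \<mu>" by auto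
    show "act ?M j b m \<in> star ?M i \<inter> lev ?M (\<mu> - j)"
      using f3_closed[OF FF *] * eql by simp
    assume a: "a \<in> F i"
    show "act ?M i a (act ?M j b m) = act ?M \<mu> (a \<otimes> b) m"
      using f3_assoc[OF FF *(1) a *(2,3)] * eql on_prod[OF FF *(1) a *(2,3)]
        on_lev[OF FF[OF a *(2)] *(3)] by auto
  qed (use lev_subgroup star_subgroup in \<open>auto simp: additive_subgroup_iff[OF ab]
       additive_subgroup_iff[OF M.abelian_group_axioms]
       lev_zero smult closed add_left add_right one eql eql' f2_lev f2_coincide
     dest: subsetD[OF lev_antimono] subsetD[OF lev_star]\<close>)
qed

text \<open>For actions that agree wherever they are meaningful but differ as functions, as happens
  with \<open>induced_act\<close> and the action of a product.\<close>

lemma (in fragment) fragment_act_cong: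
  assumes eq: "\<And>i a m. a \<in> F i \<Longrightarrow> m \<in> star M i \<Longrightarrow> act' i a m = act M i a m"
  shows "fragment R F (M\<lparr>act := act'\<rparr>)"
proof (rule fragment_act_replace)
  fix i j \<mu> a b m
  assume FF: "\<And>a b. a \<in> F i \<Longrightarrow> b \<in> F j \<Longrightarrow> a \<otimes> b \<in> F \<mu>"
    and *: "j \<le> \<mu>" and a: "a \<in> F i" and **: "b \<in> F j" "m \<in> lev M \<mu>"
  show "act' i a (act M j b m) = act M i a (act M j b m)"
    using f3_closed[OF FF * **] eq[OF a] by simp
next
  show "act' 0 a m \<in> star M i" if "a \<in> F 0" "m \<in> star M i" for i a m
    using that star_smult by (simp add: eq carrier_star_zero star_carrier)
  show "act' i (a \<oplus> b) m = act' i a m \<oplus>\<^bsub>M\<^esub> act' i b m"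
    if "a \<in> F i" "b \<in> F i" "m \<in> star M i" for i a b m
    using that additive_subgroup.a_closed[OF F_additive] by (simp add: eq act_add_left)
  show "act' i a (m \<oplus>\<^bsub>M\<^esub> n) = act' i a m \<oplus>\<^bsub>M\<^esub> act' i a n"
    if "a \<in> F i" "m \<in> star M i" "n \<in> star M i" for i a m n
    using that additive_subgroup.a_closed[OF star_subgroup] by (simp add: eq act_add_right)
qed (auto simp: eq act_closed act_one F_one dest: subsetD[OF lev_star])

section \<open>Transport and products of fragments\<close>

definition filtered_endo :: "('r, 'x) ring_scheme \<Rightarrow> (nat \<Rightarrow> 'r set) \<Rightarrow> ('r \<Rightarrow> 'r) \<Rightarrow> bool" where
  "filtered_endo R F \<tau> \<longleftrightarrow> \<tau> \<in> ring_hom R R \<and> (\<forall>i. \<tau> ` F i \<subseteq> F i)"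

text \<open>Restriction of scalars along \<open>\<tau>\<close>, carried over to the image of an
  injection \<open>f\<close> with left inverse \<open>g\<close>. The same construction twists a copy
  in place (\<open>f\<close> and \<open>g\<close> the identity), embeds it as a summand, and brings
  subfragments back to \<open>M\<close> with \<open>f\<close> and \<open>g\<close>
  exchanged.\<close>

definition transport_fragment ::
  "('r \<Rightarrow> 'r) \<Rightarrow> ('m \<Rightarrow> 'n) \<Rightarrow> ('n \<Rightarrow> 'm) \<Rightarrow> ('r, 'm) fragment \<Rightarrow> ('r, 'n) fragment" where
  "transport_fragment \<tau> f g M =
     \<lparr> carrier = f ` carrier M, mult = undefined, one = undefined,
       zero = f \<zero>\<^bsub>M\<^esub>, add = (\<lambda>x y. f (g x \<oplus>\<^bsub>M\<^esub> g y)),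
       lev = (\<lambda>i. f ` lev M i), star = (\<lambda>i. f ` star M i),
       act = (\<lambda>i a x. f (act M i (\<tau> a) (g x))) \<rparr>"

lemma transport_fragment_simps [simp]:
  "carrier (transport_fragment \<tau> f g M) = f ` carrier M"
  "\<zero>\<^bsub>transport_fragment \<tau> f g M\<^esub> = f \<zero>\<^bsub>M\<^esub>"
  "x \<oplus>\<^bsub>transport_fragment \<tau> f g M\<^esub> y = f (g x \<oplus>\<^bsub>M\<^esub> g y)"
  "lev (transport_fragment \<tau> f g M) i = f ` lev M i"
  "star (transport_fragment \<tau> f g M) i = f ` star M i"
  "act (transport_fragment \<tau> f g M) i a x = f (act M i (\<tau> a) (g x))"
  by (simp_all add: transport_fragment_def)

lemma (in fragment) fragment_transport:
  assumes \<tau>: "filtered_endo R F \<tau>" and gf: "\<And>x. x \<in> carrier M \<Longrightarrow> g (f x) = x"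
  shows "fragment R F (transport_fragment \<tau> f g M)" (is "fragment R F ?M")
proof -
  have \<tau>_F: "\<tau> a \<in> F i" if "a \<in> F i" for a i
    using \<tau> that by (auto simp: filtered_endo_def)
  have \<tau>_add: "\<tau> (a \<oplus> b) = \<tau> a \<oplus> \<tau> b" and \<tau>_mult: "\<tau> (a \<otimes> b) = \<tau> a \<otimes> \<tau> b"
    if "a \<in> F i" "b \<in> F j" for a b i j
    using \<tau> F_carrier that by (auto simp: filtered_endo_def ring_hom_add ring_hom_mult)
  have \<tau>_one: "\<tau> \<one> = \<one>"
    using \<tau> by (auto simp: filtered_endo_def ring_hom_one)
  have [simp]: "g (f x) = x" if "x \<in> lev M i" for x i using gf lev_carrier that by blast
  have [simp]: "g (f x) = x" if "x \<in> star M i" for x i using gf star_carrier that by blast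
  have ab: "abelian_group ?M"
  proof (rule abelian_groupI)
    fix x assume "x \<in> carrier ?M"
    then obtain x' where "x' \<in> carrier M" "x = f x'" by auto
    then show "\<exists>y\<in>carrier ?M. y \<oplus>\<^bsub>?M\<^esub> x = \<zero>\<^bsub>?M\<^esub>"
      by (intro bexI[of _ "f (\<ominus>\<^bsub>M\<^esub> x')"]) (simp_all add: gf M.l_neg)
  next
    show "x \<oplus>\<^bsub>?M\<^esub> y = y \<oplus>\<^bsub>?M\<^esub> x" if "x \<in> carrier ?M" "y \<in> carrier ?M" for x y
      using that M.a_comm by (force simp: gf)
  qed (auto simp: gf M.a_assoc)
  have sub: "additive_subgroup (f ` A) ?M" if A: "additive_subgroup A M" for A
  proof -
    interpret additive_subgroup A M by fact
    have "\<exists>y\<in>A. y \<oplus>\<^bsub>M\<^esub> x = \<zero>\<^bsub>M\<^esub>" if "x \<in> A" for x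
      using A that additive_subgroup_iff[OF M.abelian_group_axioms] by blast
    then show ?thesis
      unfolding additive_subgroup_iff[OF ab] using a_subset by (auto simp: gf) (metis)
  qed
  show ?thesis
  proof (intro fragment.intro fragment_axioms.intro filtered_ring_axioms ab)
    fix i j \<mu> a b m
    assume FF: "\<And>a b. a \<in> F i \<Longrightarrow> b \<in> F j \<Longrightarrow> a \<otimes> b \<in> F \<mu>"
      and *: "j \<le> \<mu>" "b \<in> F j" and "m \<in> lev ?M \<mu>"
    then obtain n where n: "n \<in> lev M \<mu>" "m = f n" by auto
    have closed: "act M j (\<tau> b) n \<in> star M i \<inter> lev M (\<mu> - j)"
      using f3_closed[OF FF *(1) \<tau>_F[OF *(2)] n(1)] .
    then show "act ?M j b m \<in> star ?M i \<inter> lev ?M (\<mu> - j)"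
      using n by auto
    assume a: "a \<in> F i"
    show "act ?M i a (act ?M j b m) = act ?M \<mu> (a \<otimes> b) m"
      using f3_assoc[OF FF *(1) \<tau>_F[OF a] \<tau>_F[OF *(2)] n(1)] n
        gf[OF star_carrier[OF IntD1[OF closed]]] \<tau>_mult[OF a *(2)] by simp
  next
    fix i j a m
    assume *: "j \<le> i" "a \<in> F j" and "m \<in> lev ?M i"
    then obtain n where n: "n \<in> lev M i" "m = f n" by auto
    show "act ?M j a m \<in> lev ?M (i - j)" "act ?M i a m = act ?M j a m"
      using f2_lev[OF *(1) \<tau>_F[OF *(2)] n(1)] f2_coincide[OF *(1) \<tau>_F[OF *(2)] n(1)] n by auto
  next
    fix i a m n
    assume a: "a \<in> F i" and "m \<in> star ?M i" "n \<in> star ?M i"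
    then obtain m' n' where *: "m' \<in> star M i" "m = f m'" "n' \<in> star M i" "n = f n'" by auto
    then show "act ?M i a (m \<oplus>\<^bsub>?M\<^esub> n) = act ?M i a m \<oplus>\<^bsub>?M\<^esub> act ?M i a n"
      using act_closed[OF \<tau>_F[OF a]] additive_subgroup.a_closed[OF star_subgroup *(1,3)]
      by (simp add: gf act_add_right[OF \<tau>_F[OF a]])
  next
    fix i a b m
    assume a: "a \<in> F i" and b: "b \<in> F i" and "m \<in> star ?M i"
    then obtain m' where *: "m' \<in> star M i" "m = f m'" by auto
    then show "act ?M i (a \<oplus> b) m = act ?M i a m \<oplus>\<^bsub>?M\<^esub> act ?M i b m"
      using act_closed[OF \<tau>_F[OF a]] act_closed[OF \<tau>_F[OF b]]
      by (simp add: gf \<tau>_add[OF a b] act_add_left[OF \<tau>_F[OF a] \<tau>_F[OF b]])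
  next
    fix i
    show "lev ?M 0 = carrier ?M" by (simp add: lev_zero)
    show "additive_subgroup (lev ?M i) ?M" "additive_subgroup (star ?M i) ?M"
      by (simp_all add: sub lev_subgroup star_subgroup)
    show "lev ?M (Suc i) \<subseteq> lev ?M i" "lev ?M i \<subseteq> star ?M i"
      by (simp_all add: image_mono lev_antimono lev_star)
  next
    fix i a m
    assume a: "a \<in> F i" and "m \<in> star ?M i"
    then obtain n where "n \<in> star M i" "m = f n" by auto
    then show "act ?M i a m \<in> carrier ?M"
      by (simp add: act_closed \<tau>_F[OF a])
  next
    fix i a m
    assume a: "a \<in> F 0" and "m \<in> star ?M i"
    then obtain n where "n \<in> star M i" "m = f n" by auto
    then show "act ?M 0 a m \<in> star ?M i"
      by (simp add: star_smult \<tau>_F[OF a])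
  next
    fix i m
    assume "m \<in> star ?M i"
    then obtain n where "n \<in> star M i" "m = f n" by auto
    then show "act ?M i \<one> m = m"
      by (simp add: \<tau>_one act_one)
  qed
qed

lemma (in fragment) body_carrier: "body M \<subseteq> carrier M"
  using lev_carrier by (auto simp: body_def)

text \<open>An intersection of images is the image of the intersection because \<open>g\<close>
  yields one and the same preimage at every level.\<close>

lemma (in fragment) body_transport:
  assumes gf: "\<And>x. x \<in> carrier M \<Longrightarrow> g (f x) = x"
  shows "body (transport_fragment \<tau> f g M) = f ` body M"
proof -
  have "g y \<in> lev M i \<and> f (g y) = y" if "y \<in> f ` lev M i" for y i
    using that gf[OF lev_carrier] by auto
  then have "y \<in> f ` body M" if "y \<in> body (transport_fragment \<tau> f g M)" for y
    using that by (intro rev_image_eqI[of "g y"]) (auto simp: body_def)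
  then show ?thesis
    by (auto simp: body_def)
qed

lemma (in fragment) essential_length_transport:
  assumes gf: "\<And>x. x \<in> carrier M \<Longrightarrow> g (f x) = x"
  shows "essential_length (transport_fragment \<tau> f g M) e \<longleftrightarrow> essential_length M e"
proof -
  have "inj_on f (carrier M)" by (rule inj_on_inverseI[of _ g, OF gf])
  then have "f ` lev M i = f ` body M \<longleftrightarrow> lev M i = body M" for i
    using inj_on_image_eq_iff[of f "carrier M" "lev M i" "body M"] lev_carrier body_carrier by auto
  moreover have "body (transport_fragment \<tau> f g M) = f ` body M" by (rule body_transport) (rule gf)
  ultimately show ?thesis
    by (simp add: essential_length_def)
qed

text \<open>A subfragment of the transported fragment is pulled back along \<open>g\<close> and
  twisted by \<open>\<tau>'\<close>. On it \<open>a\<close> acts through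
  \<open>\<tau> (\<tau>' a)\<close>, hence as in \<open>M\<close>, so it is a subfragment of
  \<open>M\<close> and trivial there. Triviality involves levels, bodies and zero only, and these
  correspond under \<open>f\<close>.\<close>

lemma irreducible_transport:
  fixes R (structure)
  assumes irr: "irreducible_fragment R F M"
    and \<tau>: "filtered_endo R F \<tau>" and \<tau>': "filtered_endo R F \<tau>'"
    and \<tau>\<tau>': "\<And>i a. a \<in> F i \<Longrightarrow> \<tau> (\<tau>' a) = a"
    and gf: "\<And>x. x \<in> carrier M \<Longrightarrow> g (f x) = x"
  shows "irreducible_fragment R F (transport_fragment \<tau> f g M)"
proof -
  interpret fragment R F M using irr by (simp add: irreducible_fragment_def)
  let ?M = "transport_fragment \<tau> f g M"
  have frag: "fragment R F ?M" by (rule fragment_transport[where f = f and g = g, OF \<tau> gf])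
  have "trivial_subfragment L ?M" if L: "subfragment R F L ?M" for L
  proof -
    interpret L: fragment R F L using L by (simp add: subfragment_def)
    let ?L = "transport_fragment \<tau>' g f L"
    have levL: "lev L i \<subseteq> f ` lev M i" for i
      using L by (simp add: subfragment_def)
    \<comment> \<open>The carrier of \<open>L\<close> lies in the image of \<open>f\<close>, so on
      \<open>L\<close> the two maps exchange their roles: \<open>g\<close> is the injection and
      \<open>f\<close> its left inverse.\<close>
    have fg: "f (g y) = y" if "y \<in> carrier L" for y
      using levL[of 0] that gf by (auto simp: L.lev_zero lev_zero)
    have fg_lev: "f (g y) = y" if "y \<in> lev L i" for i y
      using fg L.lev_carrier that by blast
    have g_lev: "g y \<in> lev M i" if y: "y \<in> lev L i" for i y
    proof -
      obtain x where "x \<in> lev M i" "y = f x" using levL y by blast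
      then show ?thesis using gf[OF lev_carrier] by simp
    qed
    have g_carrier: "g y \<in> carrier M" if "y \<in> carrier L" for y
      using g_lev[of y 0] that by (simp add: L.lev_zero lev_zero)
    have addL: "x \<oplus>\<^bsub>L\<^esub> y = f (g x \<oplus>\<^bsub>M\<^esub> g y)" if "x \<in> carrier L" "y \<in> carrier L" for x y
      using L that by (simp add: subfragment_def)
    have zeroL: "\<zero>\<^bsub>L\<^esub> = f \<zero>\<^bsub>M\<^esub>"
      using L by (simp add: subfragment_def)
    have actL: "act L i a y = f (act M i (\<tau> a) (g y))" if "a \<in> F i" "y \<in> lev L i" for i a y
      using L that by (simp add: subfragment_def)
    have "subfragment R F ?L M"
      unfolding subfragment_def
    proof (intro conjI allI ballI fragment_axioms L.fragment_transport[where f = g and g = f, OF \<tau>' fg])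
      show "x \<oplus>\<^bsub>?L\<^esub> y = x \<oplus>\<^bsub>M\<^esub> y" if "x \<in> carrier ?L" "y \<in> carrier ?L" for x y
        using that g_carrier by (auto simp: fg addL gf)
      show "act ?L i a n = act M i a n" if a: "a \<in> F i" and n: "n \<in> lev ?L i" for i a n
      proof -
        obtain y where y: "y \<in> lev L i" "n = g y" using n by auto
        have \<tau>'a: "\<tau>' a \<in> F i" using \<tau>' a by (auto simp: filtered_endo_def)
        have "act ?L i a n = g (f (act M i (\<tau> (\<tau>' a)) (g y)))"
          using y by (simp add: fg_lev actL[OF \<tau>'a])
        also have "\<dots> = act M i a n"
          using y a gf[OF act_closed[OF a subsetD[OF lev_star g_lev[OF y(1)]]]] by (simp add: \<tau>\<tau>')
        finally show ?thesis .
      qed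
    qed (use g_lev gf in \<open>auto simp: zeroL\<close>)
    then have triv: "trivial_subfragment ?L M"
      using irr by (simp add: irreducible_fragment_def)
    have injf: "inj_on f (carrier M)" by (rule inj_on_inverseI[of _ g, OF gf])
    have injg: "inj_on g (carrier L)" by (rule inj_on_inverseI[of _ f, OF fg])
    have "body ?M = f ` body M" by (rule body_transport) (rule gf)
    then have bodyM: "lev ?M k = body ?M \<longleftrightarrow> lev M k = body M" for k
      using inj_on_image_eq_iff[OF injf, of "lev M k" "body M"] lev_carrier body_carrier by auto
    have "body ?L = g ` body L" by (rule L.body_transport) (rule fg)
    then have bodyL: "lev ?L k = body ?L \<longleftrightarrow> lev L k = body L" for k
      using inj_on_image_eq_iff[OF injg, of "lev L k" "body L"] L.lev_carrier L.body_carrier by auto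
    have zeroM: "lev ?M k = {\<zero>\<^bsub>?M\<^esub>} \<longleftrightarrow> lev M k = {\<zero>\<^bsub>M\<^esub>}" for k
    proof -
      show ?thesis
        using inj_on_image_eq_iff[OF injf, of "lev M k" "{\<zero>\<^bsub>M\<^esub>}"] lev_carrier by auto
    qed
    \<comment> \<open>Applying \<open>f\<close> recovers the levels of \<open>L\<close> from those
      of its pullback, which pushes (T2) and (T3) forward with the same \<open>k\<close> and the
      same \<open>\<alpha>\<close>.\<close>
    have lev_fg: "f ` lev ?L k = lev L k" for k
      using fg_lev by (force simp: image_image)
    have zeroL: "lev L k = {\<zero>\<^bsub>?M\<^esub>}" if "lev ?L k = {\<zero>\<^bsub>M\<^esub>}" for k
      using lev_fg[of k] that by simp
    have levT: "lev L k = lev ?M j" if "lev ?L k = lev M j" for k j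
      using lev_fg[of k] that by simp
    from triv consider (1) k where "lev ?L k = body ?L" "lev M k \<noteq> body M"
      | (2) k where "lev ?L k = {\<zero>\<^bsub>M\<^esub>}" "lev M k \<noteq> {\<zero>\<^bsub>M\<^esub>}"
      | (3) \<alpha> :: "nat \<Rightarrow> nat" where "mono \<alpha>" "\<forall>k. lev ?L k = lev M (\<alpha> k)"
          "\<forall>k. \<forall>l\<le>k. \<alpha> (k - l) + l \<le> \<alpha> k"
      unfolding trivial_subfragment_def by (elim disjE exE conjE) (rule that; assumption)+
    then show ?thesis
    proof cases
      case (1 k)
      have "lev L k = body L" by (rule bodyL[THEN iffD1, OF 1(1)])
      moreover have "lev ?M k \<noteq> body ?M" using 1(2) by (rule contrapos_nn) (rule bodyM[THEN iffD1])
      ultimately show ?thesis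
        unfolding trivial_subfragment_def by - (rule disjI1, intro exI[of _ k] conjI)
    next
      case (2 k)
      have "lev L k = {\<zero>\<^bsub>?M\<^esub>}" by (rule zeroL[OF 2(1)])
      moreover have "lev ?M k \<noteq> {\<zero>\<^bsub>?M\<^esub>}" using 2(2) by (rule contrapos_nn) (rule zeroM[THEN iffD1])
      ultimately show ?thesis
        unfolding trivial_subfragment_def by - (rule disjI2, rule disjI1, intro exI[of _ k] conjI)
    next
      case (3 \<alpha>)
      have "\<forall>k. lev L k = lev ?M (\<alpha> k)" by (intro allI levT 3(2)[rule_format])
      with 3(1,3) show ?thesis
        unfolding trivial_subfragment_def by - (rule disjI2, rule disjI2, intro exI[of _ \<alpha>] conjI)
    qed
  qed
  then show ?thesis
    using frag by (simp add: irreducible_fragment_def)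
qed

text \<open>Extensional functions and the \<open>undefined\<close> fields match
  \<open>coset_tensor\<close>, so that the induced fragment equals such a product as a record, up to
  its action.\<close>

definition product_fragment :: "'i set \<Rightarrow> ('i \<Rightarrow> ('r, 'm) fragment) \<Rightarrow> ('r, 'i \<Rightarrow> 'm) fragment" where
  "product_fragment I P =
     \<lparr> carrier = (\<Pi>\<^sub>E c\<in>I. carrier (P c)), mult = undefined, one = undefined,
       zero = (\<lambda>c\<in>I. \<zero>\<^bsub>P c\<^esub>), add = (\<lambda>x y. \<lambda>c\<in>I. x c \<oplus>\<^bsub>P c\<^esub> y c),
       lev = (\<lambda>i. \<Pi>\<^sub>E c\<in>I. lev (P c) i), star = (\<lambda>i. \<Pi>\<^sub>E c\<in>I. star (P c) i),
       act = (\<lambda>i a x. \<lambda>c\<in>I. act (P c) i a (x c)) \<rparr>"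

lemma product_fragment_simps [simp]:
  "carrier (product_fragment I P) = (\<Pi>\<^sub>E c\<in>I. carrier (P c))"
  "\<zero>\<^bsub>product_fragment I P\<^esub> = (\<lambda>c\<in>I. \<zero>\<^bsub>P c\<^esub>)"
  "x \<oplus>\<^bsub>product_fragment I P\<^esub> y = (\<lambda>c\<in>I. x c \<oplus>\<^bsub>P c\<^esub> y c)"
  "lev (product_fragment I P) i = (\<Pi>\<^sub>E c\<in>I. lev (P c) i)"
  "star (product_fragment I P) i = (\<Pi>\<^sub>E c\<in>I. star (P c) i)"
  "act (product_fragment I P) i a x = (\<lambda>c\<in>I. act (P c) i a (x c))"
  by (simp_all add: product_fragment_def)

lemma fragment_product:
  fixes R (structure)
  assumes R: "filtered_ring R F" and P: "\<And>c. c \<in> I \<Longrightarrow> fragment R F (P c)"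
  shows "fragment R F (product_fragment I P)" (is "fragment R F ?M")
proof -
  have abP: "abelian_group (P c)" if "c \<in> I" for c
    using P[OF that] by (simp add: fragment_def)
  note [simp] = abelian_groupE(1-3,5)[OF abP]
  have ab: "abelian_group ?M"
  proof (rule abelian_groupI)
    fix x assume "x \<in> carrier ?M"
    then have "\<forall>c\<in>I. \<exists>y\<in>carrier (P c). y \<oplus>\<^bsub>P c\<^esub> x c = \<zero>\<^bsub>P c\<^esub>"
      using abelian_groupE(6)[OF abP] by (auto simp: PiE_iff)
    then obtain y where "\<forall>c\<in>I. y c \<in> carrier (P c) \<and> y c \<oplus>\<^bsub>P c\<^esub> x c = \<zero>\<^bsub>P c\<^esub>"
      by metis
    then show "\<exists>y\<in>carrier ?M. y \<oplus>\<^bsub>?M\<^esub> x = \<zero>\<^bsub>?M\<^esub>"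
      by (intro bexI[of _ "restrict y I"]) (auto intro!: restrict_ext)
  next
    show "x \<oplus>\<^bsub>?M\<^esub> y = y \<oplus>\<^bsub>?M\<^esub> x" if "x \<in> carrier ?M" "y \<in> carrier ?M" for x y
      using that abelian_groupE(4)[OF abP] by (auto simp: PiE_iff intro!: restrict_ext)
  qed (auto simp: PiE_iff extensional_def fun_eq_iff)
  have sub: "additive_subgroup (\<Pi>\<^sub>E c\<in>I. A c) ?M" if A: "\<And>c. c \<in> I \<Longrightarrow> additive_subgroup (A c) (P c)" for A
    unfolding additive_subgroup_iff[OF ab]
  proof (intro conjI ballI)
    have A': "A c \<subseteq> carrier (P c) \<and> \<zero>\<^bsub>P c\<^esub> \<in> A c \<and> (\<forall>x\<in>A c. \<forall>y\<in>A c. x \<oplus>\<^bsub>P c\<^esub> y \<in> A c) \<and>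
        (\<forall>x\<in>A c. \<exists>y\<in>A c. y \<oplus>\<^bsub>P c\<^esub> x = \<zero>\<^bsub>P c\<^esub>)" if "c \<in> I" for c
      using A[OF that] unfolding additive_subgroup_iff[OF abP[OF that]] .
    show "\<exists>y\<in>\<Pi>\<^sub>E c\<in>I. A c. y \<oplus>\<^bsub>?M\<^esub> x = \<zero>\<^bsub>?M\<^esub>" if "x \<in> (\<Pi>\<^sub>E c\<in>I. A c)" for x
    proof -
      have "\<forall>c\<in>I. \<exists>y\<in>A c. y \<oplus>\<^bsub>P c\<^esub> x c = \<zero>\<^bsub>P c\<^esub>"
        using A' that by (auto simp: PiE_iff)
      then obtain y where "\<forall>c\<in>I. y c \<in> A c \<and> y c \<oplus>\<^bsub>P c\<^esub> x c = \<zero>\<^bsub>P c\<^esub>"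
        by metis
      then show ?thesis
        by (intro bexI[of _ "restrict y I"]) (auto intro!: restrict_ext)
    qed
    show "(\<Pi>\<^sub>E c\<in>I. A c) \<subseteq> carrier ?M"
      using conjunct1[OF A'] by (auto intro!: PiE_mono)
    show "\<zero>\<^bsub>?M\<^esub> \<in> (\<Pi>\<^sub>E c\<in>I. A c)"
      using A' by auto
    show "x \<oplus>\<^bsub>?M\<^esub> y \<in> (\<Pi>\<^sub>E c\<in>I. A c)"
      if "x \<in> (\<Pi>\<^sub>E c\<in>I. A c)" "y \<in> (\<Pi>\<^sub>E c\<in>I. A c)" for x y
      using A' that by (auto simp: PiE_iff)
  qed
  show ?thesis
  proof (intro fragment.intro fragment_axioms.intro R ab)
    fix i j \<mu> a b m
    assume FF: "\<And>a b. a \<in> F i \<Longrightarrow> b \<in> F j \<Longrightarrow> a \<otimes> b \<in> F \<mu>"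
      and *: "j \<le> \<mu>" "b \<in> F j" and m: "m \<in> lev ?M \<mu>"
    show "act ?M j b m \<in> star ?M i \<inter> lev ?M (\<mu> - j)"
      using fragment.f3_closed[OF P FF *] m by (auto simp: PiE_iff)
    assume a: "a \<in> F i"
    show "act ?M i a (act ?M j b m) = act ?M \<mu> (a \<otimes> b) m"
      using fragment.f3_assoc[OF P FF *(1) a *(2)] m by (auto simp: PiE_iff intro!: restrict_ext)
  next
    fix i
    show "lev ?M 0 = carrier ?M"
      by (auto intro!: PiE_cong simp: fragment.lev_zero[OF P])
    show "additive_subgroup (lev ?M i) ?M" "additive_subgroup (star ?M i) ?M"
      by (simp_all add: sub fragment.lev_subgroup[OF P] fragment.star_subgroup[OF P])
    show "lev ?M (Suc i) \<subseteq> lev ?M i" "lev ?M i \<subseteq> star ?M i"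
      by (simp_all add: PiE_mono fragment.lev_antimono[OF P] fragment.lev_star[OF P])
  qed (auto simp: fragment.star_smult[OF P] fragment.act_closed[OF P] fragment.act_add_left[OF P]
      fragment.act_add_right[OF P] fragment.act_one[OF P] fragment.f2_lev[OF P]
      fragment.f2_coincide[OF P] PiE_iff fun_eq_iff extensional_def)
qed

section \<open>Twisting the group algebra by conjugation\<close>

lemma (in group) bij_betw_conjugation:
  assumes N: "N \<lhd> G" and t: "t \<in> carrier G"
  shows "bij_betw (\<lambda>x. t \<otimes> x \<otimes> inv t) N N"
proof (rule bij_betwI[of _ _ _ "\<lambda>x. inv t \<otimes> x \<otimes> t"])
  interpret N: normal N G by fact
  show "(\<lambda>x. t \<otimes> x \<otimes> inv t) \<in> N \<rightarrow> N" "(\<lambda>x. inv t \<otimes> x \<otimes> t) \<in> N \<rightarrow> N"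
    using t N.inv_op_closed1 N.inv_op_closed2 by auto
  show "inv t \<otimes> (t \<otimes> x \<otimes> inv t) \<otimes> t = x" "t \<otimes> (inv t \<otimes> x \<otimes> t) \<otimes> inv t = x" if "x \<in> N" for x
    using t N.mem_carrier[OF that] by (simp_all add: m_assoc) (simp_all flip: m_assoc)
qed

locale normal_filtration = K: field K + normal H G
  for K :: "('k, 'x) ring_scheme" and H :: "'g set" and G :: "('g, 'y) monoid_scheme" (structure) +
  fixes d :: nat and Gs :: "nat \<Rightarrow> 'g set"
  assumes finite_G: "finite (carrier G)"
    and Gs_zero: "Gs 0 = {\<one>}" and Gs_top: "Gs d = carrier G"
    and Gs_subgroup: "i \<le> d \<Longrightarrow> subgroup (Gs i) G"
    and HGs_normal: "i \<le> d \<Longrightarrow> H \<inter> Gs i \<lhd> G"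
begin

abbreviation "KH \<equiv> group_algebra K (G\<lparr>carrier := H\<rparr>)"
abbreviation "FKH \<equiv> group_filtration K (G\<lparr>carrier := H\<rparr>) d (\<lambda>i. H \<inter> Gs i)"
text \<open>The cap at \<open>d\<close> is needed since \<open>Gs\<close> is arbitrary beyond
  \<open>d\<close>, whereas the filtration stays at \<open>KH\<close> from there on.\<close>

abbreviation "HGs i \<equiv> H \<inter> Gs (min i d)"

lemma HGs_top: "H \<inter> Gs d = H"
  using Gs_top subset by auto

lemma finite_HGs: "finite (HGs i)"
  using finite_G subset finite_subset by blast

section \<open>Coefficients and monomials in \<open>KH\<close> and its filtration\<close>

lemma carrier_KH: "carrier KH = {a. (\<forall>g\<in>H. a g \<in> carrier K) \<and> (\<forall>g. g \<notin> H \<longrightarrow> a g = \<zero>\<^bsub>K\<^esub>)}"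
  by (simp add: group_algebra_def)

lemma FKH_iff: "a \<in> FKH i \<longleftrightarrow> (\<forall>g\<in>HGs i. a g \<in> carrier K) \<and> (\<forall>g. g \<notin> HGs i \<longrightarrow> a g = \<zero>\<^bsub>K\<^esub>)"
  using HGs_top by (auto simp: group_filtration_def group_algebra_def min_def)

lemma FKH_carrier: "a \<in> FKH i \<Longrightarrow> a g \<in> carrier K"
  by (cases "g \<in> HGs i") (auto simp: FKH_iff)

lemma KH_one: "\<one>\<^bsub>KH\<^esub> = monomial K \<one>\<^bsub>K\<^esub> \<one>"
  by (simp add: group_algebra_def monomial_def)

lemma KH_zero: "\<zero>\<^bsub>KH\<^esub> = (\<lambda>g. \<zero>\<^bsub>K\<^esub>)"
  by (simp add: group_algebra_def)

lemma KH_add: "a \<oplus>\<^bsub>KH\<^esub> b = (\<lambda>g. a g \<oplus>\<^bsub>K\<^esub> b g)"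
  by (simp add: group_algebra_def)

lemma KH_mult: "a \<otimes>\<^bsub>KH\<^esub> b =
    (\<lambda>g. if g \<in> H then (\<Oplus>\<^bsub>K\<^esub>x\<in>H. a x \<otimes>\<^bsub>K\<^esub> b (inv\<^bsub>G\<lparr>carrier := H\<rparr>\<^esub> x \<otimes> g)) else \<zero>\<^bsub>K\<^esub>)"
  by (simp add: group_algebra_def cong: if_cong)

lemma KH_mult_apply:
  assumes "a \<in> carrier KH" "b \<in> carrier KH" "g \<in> H"
  shows "(a \<otimes>\<^bsub>KH\<^esub> b) g = (\<Oplus>\<^bsub>K\<^esub>x\<in>H. a x \<otimes>\<^bsub>K\<^esub> b (inv x \<otimes> g))"
  unfolding KH_mult using assms
  by (auto intro!: K.finsum_cong' simp: m_inv_consistent[OF subgroup_axioms] carrier_KH)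

lemma monomial_zero: "monomial K \<zero>\<^bsub>K\<^esub> g = \<zero>\<^bsub>KH\<^esub>"
  by (auto simp: monomial_def KH_zero)

lemma monomial_FKH: "c \<in> carrier K \<Longrightarrow> u \<in> HGs i \<Longrightarrow> monomial K c u \<in> FKH i"
  by (auto simp: FKH_iff monomial_def)

lemma monomial_FKH_one: "c \<in> carrier K \<Longrightarrow> monomial K c \<one> \<in> FKH 0"
  by (rule monomial_FKH) (simp_all add: Gs_zero)

lemma monomial_add: "monomial K (c \<oplus>\<^bsub>K\<^esub> c') g = monomial K c g \<oplus>\<^bsub>KH\<^esub> monomial K c' g"
  if "c \<in> carrier K" "c' \<in> carrier K"
  using that by (auto simp: KH_add monomial_def)

text \<open>Only the term at the identity survives in the convolution. Together with (f3) this
  merges the two-step action of a scalar and a group element into one.\<close>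

lemma monomial_mult:
  assumes c: "c \<in> carrier K" and u: "u \<in> H"
  shows "monomial K c \<one> \<otimes>\<^bsub>KH\<^esub> monomial K \<one>\<^bsub>K\<^esub> u = monomial K c u"
proof
  fix g
  show "(monomial K c \<one> \<otimes>\<^bsub>KH\<^esub> monomial K \<one>\<^bsub>K\<^esub> u) g = monomial K c u g"
  proof (cases "g \<in> H")
    case True
    have "(monomial K c \<one> \<otimes>\<^bsub>KH\<^esub> monomial K \<one>\<^bsub>K\<^esub> u) g =
        (\<Oplus>\<^bsub>K\<^esub>x\<in>H. monomial K c \<one> x \<otimes>\<^bsub>K\<^esub> monomial K \<one>\<^bsub>K\<^esub> u (inv x \<otimes> g))"
      using c u True by (intro KH_mult_apply) (auto simp: carrier_KH monomial_def)
    also have "\<dots> = (\<Oplus>\<^bsub>K\<^esub>x\<in>H. if x = \<one> then c \<otimes>\<^bsub>K\<^esub> monomial K \<one>\<^bsub>K\<^esub> u (inv x \<otimes> g) else \<zero>\<^bsub>K\<^esub>)"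
      using c by (intro K.finsum_cong') (auto simp: monomial_def)
    also have "\<dots> = c \<otimes>\<^bsub>K\<^esub> monomial K \<one>\<^bsub>K\<^esub> u (inv \<one> \<otimes> g)"
      using c finite_subset[OF subset finite_G]
      by (intro K.add.finprod_singleton_swap) (auto simp: monomial_def)
    also have "\<dots> = monomial K c u g"
      using c True by (auto simp: monomial_def)
    finally show ?thesis .
  qed (use u in \<open>auto simp: KH_mult monomial_def\<close>)
qed

text \<open>Evaluation at \<open>g\<close> is additive. The group structure of \<open>KH\<close>
  enters as an assumption; it is later read off from the fragment \<open>N\<close>, whose axioms
  contain that \<open>KH\<close> is a ring.\<close>

lemma finsum_KH_apply:
  assumes "abelian_group KH" "f \<in> I \<rightarrow> carrier KH"
  shows "finsum KH f I g = finsum K (\<lambda>i. f i g) I"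
proof -
  have "a g \<in> carrier K" if "a \<in> carrier KH" for a
    using that by (cases "g \<in> H") (auto simp: carrier_KH)
  then show ?thesis
    using assms K.abelian_group_axioms
    by (intro additive_map_finsum[of _ _ "\<lambda>a. a g"]) (simp_all add: KH_zero KH_add)
qed

lemma FKH_decompose:
  assumes "abelian_group KH" and a: "a \<in> FKH i"
  shows "a = (\<Oplus>\<^bsub>KH\<^esub>u\<in>HGs i. monomial K (a u) u)"
proof
  fix g
  have "monomial K (a u) u \<in> carrier KH" if "u \<in> HGs i" for u
    using a that FKH_carrier by (auto simp: carrier_KH monomial_def)
  then have "(\<Oplus>\<^bsub>KH\<^esub>u\<in>HGs i. monomial K (a u) u) g = (\<Oplus>\<^bsub>K\<^esub>u\<in>HGs i. monomial K (a u) u g)"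
    by (intro finsum_KH_apply[OF assms(1)]) auto
  also have "\<dots> = (\<Oplus>\<^bsub>K\<^esub>u\<in>HGs i. if g = u then a u else \<zero>\<^bsub>K\<^esub>)"
    using FKH_carrier[OF a] by (intro K.finsum_cong') (auto simp: monomial_def)
  also have "\<dots> = a g"
  proof (cases "g \<in> HGs i")
    case True
    then show ?thesis
      by (intro K.finsum_singleton finite_HGs) (use FKH_carrier[OF a] in auto)
  next
    case False
    then have "(\<Oplus>\<^bsub>K\<^esub>u\<in>HGs i. if g = u then a u else \<zero>\<^bsub>K\<^esub>) = \<zero>\<^bsub>K\<^esub>"
      by (intro K.add.finprod_one_eqI) auto
    then show ?thesis using a False by (simp add: FKH_iff)
  qed
  finally show "a g = (\<Oplus>\<^bsub>KH\<^esub>u\<in>HGs i. monomial K (a u) u) g" by simp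
qed

text \<open>The automorphism \<open>h \<mapsto> t\<^sup>-\<^sup>1 h t\<close> of \<open>KH\<close>: on the summand \<open>K c \<otimes> N\<close> with \<open>\<sigma>(c) = t\<close>, the element \<open>h\<close>
  of \<open>H\<close> acts as \<open>t\<^sup>-\<^sup>1 h t\<close> does on \<open>N\<close>.\<close>

definition conj_twist :: "'g \<Rightarrow> ('g \<Rightarrow> 'k) \<Rightarrow> 'g \<Rightarrow> 'k" where
  "conj_twist t a = (\<lambda>x. if x \<in> H then a (t \<otimes> x \<otimes> inv t) else \<zero>\<^bsub>K\<^esub>)"

lemma normal_H: "H \<lhd> G"
  by (rule normal_axioms)

text \<open>Conjugation by \<open>t\<close> permutes both \<open>H\<close> and its subset
  \<open>HGs i\<close>, and an injective map that sends a subset onto itself also reflects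
  membership in it.\<close>

lemma HGs_conj:
  assumes t: "t \<in> carrier G" and x: "x \<in> H"
  shows "t \<otimes> x \<otimes> inv t \<in> HGs i \<longleftrightarrow> x \<in> HGs i"
proof -
  have N: "HGs i \<lhd> G" by (rule HGs_normal) simp
  note bij = bij_betw_conjugation[OF N t] bij_betw_conjugation[OF normal_H t]
  show ?thesis
    using inj_on_image_mem_iff[OF bij_betw_imp_inj_on[OF bij(2)] x Int_lower1, of "Gs (min i d)"]
    unfolding bij_betw_imp_surj_on[OF bij(1)] .
qed

lemma conj_twist_endo:
  assumes t: "t \<in> carrier G"
  shows "filtered_endo KH FKH (conj_twist t)"
  unfolding filtered_endo_def
proof (intro conjI allI ring_hom_memI)
  have conj: "t \<otimes> x \<otimes> inv t \<in> H" if "x \<in> H" for x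
    using that t inv_op_closed2 by blast
  show "conj_twist t ` FKH i \<subseteq> FKH i" for i
  proof (clarsimp simp only: FKH_iff[of "conj_twist t _"], intro conjI ballI allI impI)
    fix a g assume a: "a \<in> FKH i"
    show "conj_twist t a g \<in> carrier K" using FKH_carrier[OF a] by (simp add: conj_twist_def)
    show "conj_twist t a g = \<zero>\<^bsub>K\<^esub>" if "g \<notin> HGs i"
      using a that HGs_conj[OF t, of g i] unfolding FKH_iff conj_twist_def by metis
  qed
  show closed: "conj_twist t a \<in> carrier KH" if "a \<in> carrier KH" for a
    using that conj by (auto simp: carrier_KH conj_twist_def)
  show "conj_twist t (a \<oplus>\<^bsub>KH\<^esub> b) = conj_twist t a \<oplus>\<^bsub>KH\<^esub> conj_twist t b" for a b
    by (auto simp: KH_add conj_twist_def)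
  show "conj_twist t \<one>\<^bsub>KH\<^esub> = \<one>\<^bsub>KH\<^esub>"
  proof
    fix x
    have "t \<otimes> x \<otimes> inv t = \<one> \<longleftrightarrow> x = \<one>" if "x \<in> H"
      using t mem_carrier[OF that] by (simp add: inv_solve_right')
    then show "conj_twist t \<one>\<^bsub>KH\<^esub> x = \<one>\<^bsub>KH\<^esub> x"
      by (auto simp: KH_one monomial_def conj_twist_def)
  qed
  show "conj_twist t (a \<otimes>\<^bsub>KH\<^esub> b) = conj_twist t a \<otimes>\<^bsub>KH\<^esub> conj_twist t b"
    if a: "a \<in> carrier KH" and b: "b \<in> carrier KH" for a b
  proof
    fix g
    show "conj_twist t (a \<otimes>\<^bsub>KH\<^esub> b) g = (conj_twist t a \<otimes>\<^bsub>KH\<^esub> conj_twist t b) g"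
    proof (cases "g \<in> H")
      case g: True
      let ?h = "\<lambda>x. t \<otimes> x \<otimes> inv t"
      let ?f = "\<lambda>y. a y \<otimes>\<^bsub>K\<^esub> b (inv y \<otimes> ?h g)"
      note bij = bij_betw_conjugation[OF normal_H t]
      have f: "?f \<in> H \<rightarrow> carrier K"
        using a b g conj by (auto simp: carrier_KH)
      have "conj_twist t (a \<otimes>\<^bsub>KH\<^esub> b) g = finsum K ?f H"
        using g a b conj by (simp add: conj_twist_def KH_mult_apply)
      also have "\<dots> = finsum K ?f (?h ` H)"
        using bij_betw_imp_surj_on[OF bij] by simp
      \<comment> \<open>Substituting y = t x t^-1 in the convolution is what makes the twist
        multiplicative.\<close>
      also have "\<dots> = finsum K (\<lambda>x. ?f (?h x)) H"
        using f bij_betw_imp_surj_on[OF bij] bij_betw_imp_inj_on[OF bij]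
        by (intro K.finsum_reindex) auto
      also have "\<dots> = (\<Oplus>\<^bsub>K\<^esub>x\<in>H. conj_twist t a x \<otimes>\<^bsub>K\<^esub> conj_twist t b (inv x \<otimes> g))"
      proof (rule K.finsum_cong')
        fix x assume x: "x \<in> H"
        have "inv (?h x) \<otimes> ?h g = ?h (inv x \<otimes> g)"
          using t mem_carrier[OF x] mem_carrier[OF g]
          by (simp add: inv_mult_group m_assoc) (simp flip: m_assoc)
        then show "?f (?h x) = conj_twist t a x \<otimes>\<^bsub>K\<^esub> conj_twist t b (inv x \<otimes> g)"
          using x g by (simp add: conj_twist_def)
      qed (use closed[OF a] closed[OF b] g in \<open>auto simp: carrier_KH\<close>)
      also have "\<dots> = (conj_twist t a \<otimes>\<^bsub>KH\<^esub> conj_twist t b) g"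
        using closed[OF a] closed[OF b] g by (simp add: KH_mult_apply)
      finally show ?thesis .
    qed (simp add: conj_twist_def KH_mult)
  qed
qed

lemma conj_twist_inverse:
  assumes t: "t \<in> carrier G" and a: "a \<in> FKH i"
  shows "conj_twist t (conj_twist (inv t) a) = a"
proof
  fix x
  have "inv t \<otimes> (t \<otimes> x \<otimes> inv t) \<otimes> t = x" if "x \<in> H"
    using t mem_carrier[OF that] by (simp add: m_assoc) (simp flip: m_assoc)
  then show "conj_twist t (conj_twist (inv t) a) x = a x"
    using t a by (auto simp: conj_twist_def inv_op_closed2 FKH_iff)
qed

end

section \<open>The induced fragment over the subgroup\<close>

locale normal_filtration_fragment = normal_filtration K H G d Gs +
  N: fragment "group_algebra K (G\<lparr>carrier := H\<rparr>)"
    "group_filtration K (G\<lparr>carrier := H\<rparr>) d (\<lambda>i. H \<inter> Gs i)" N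
  for K :: "('k, 'x) ring_scheme" and H :: "'g set" and G :: "('g, 'y) monoid_scheme" (structure)
    and d :: nat and Gs :: "nat \<Rightarrow> 'g set" and N :: "('g \<Rightarrow> 'k, 'm) fragment"
begin

text \<open>The action of a group algebra element computed from those of group elements, as in the induced
  fragment. Outside the levels it may differ from the action of \<open>N\<close>, because nothing relates
  \<open>act N j\<close> to scalars there.\<close>

definition expanded_act :: "nat \<Rightarrow> ('g \<Rightarrow> 'k) \<Rightarrow> 'm \<Rightarrow> 'm" where
  "expanded_act j a x = (\<Oplus>\<^bsub>N\<^esub>u\<in>HGs j. act N 0 (monomial K (a u) \<one>) (act N j (monomial K \<one>\<^bsub>K\<^esub> u) x))"

lemma scalar_act_closed:
  assumes "c \<in> carrier K" "u \<in> HGs j" "x \<in> star N j"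
  shows "act N 0 (monomial K c \<one>) (act N j (monomial K \<one>\<^bsub>K\<^esub> u) x) \<in> carrier N"
proof -
  have "act N j (monomial K \<one>\<^bsub>K\<^esub> u) x \<in> carrier N"
    using assms by (intro N.act_closed monomial_FKH) auto
  then show ?thesis
    using assms N.carrier_star_zero by (intro N.act_closed monomial_FKH_one) auto
qed

text \<open>\<open>a\<close> is the sum of its monomials and \<open>act N j\<close> is additive, so
  both sides agree once scalars can be absorbed. The hypothesis \<open>scalar\<close> is an instance
  of associativity that (f3) grants on levels and on products, but not on all of
  \<open>star N j\<close>.\<close>

lemma expanded_act_eq:
  assumes a: "a \<in> FKH j" and x: "x \<in> star N j"
    and scalar: "\<And>c u. c \<in> carrier K \<Longrightarrow> u \<in> HGs j \<Longrightarrow>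
      act N 0 (monomial K c \<one>) (act N j (monomial K \<one>\<^bsub>K\<^esub> u) x) = act N j (monomial K c u) x"
  shows "expanded_act j a x = act N j a x"
proof -
  have "act N j a x = act N j (\<Oplus>\<^bsub>KH\<^esub>u\<in>HGs j. monomial K (a u) u) x"
    using FKH_decompose[OF N.abelian_group_axioms a] by simp
  also have "\<dots> = (\<Oplus>\<^bsub>N\<^esub>u\<in>HGs j. act N j (monomial K (a u) u) x)"
    using FKH_carrier[OF a] by (intro N.act_finsum_left finite_HGs x) (auto intro: monomial_FKH)
  also have "\<dots> = expanded_act j a x"
    unfolding expanded_act_def
    using FKH_carrier[OF a] scalar_act_closed[OF _ _ x] by (intro N.M.finsum_cong') (auto simp: scalar)
  finally show ?thesis by simp
qed

lemma expanded_act_lev: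
  assumes a: "a \<in> FKH j" and x: "x \<in> lev N j"
  shows "expanded_act j a x = act N j a x"
proof (rule expanded_act_eq[OF a])
  fix c u assume *: "c \<in> carrier K" "u \<in> HGs j"
  have FF: "a \<otimes>\<^bsub>KH\<^esub> b \<in> FKH j" if "a \<in> FKH 0" "b \<in> FKH j" for a b
    using N.F_mult[OF that] by simp
  show "act N 0 (monomial K c \<one>) (act N j (monomial K \<one>\<^bsub>K\<^esub> u) x) = act N j (monomial K c u) x"
    using * N.f3_assoc[OF FF order_refl monomial_FKH_one monomial_FKH x] monomial_mult by simp
qed (use x N.lev_star in auto)

lemma expanded_act_product:
  assumes FF: "\<And>a b. a \<in> FKH i \<Longrightarrow> b \<in> FKH j \<Longrightarrow> a \<otimes>\<^bsub>KH\<^esub> b \<in> FKH \<mu>"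
    and j: "j \<le> \<mu>" and a: "a \<in> FKH i" and b: "b \<in> FKH j" and m: "m \<in> lev N \<mu>"
  shows "expanded_act i a (act N j b m) = act N i a (act N j b m)"
proof (rule expanded_act_eq[OF a])
  show "act N j b m \<in> star N i"
    using N.f3_closed[OF FF j b m] by simp
  fix c u assume c: "c \<in> carrier K" and u: "u \<in> HGs i"
  have mon: "monomial K c \<one> \<in> FKH 0" "monomial K \<one>\<^bsub>K\<^esub> u \<in> FKH i" "monomial K c u \<in> FKH i"
    using c u by (auto intro: monomial_FKH monomial_FKH_one)
  have F0: "a \<otimes>\<^bsub>KH\<^esub> b \<in> FKH \<mu>" if "a \<in> FKH 0" "b \<in> FKH \<mu>" for a b
    using N.F_mult[OF that] by simp
  \<comment> \<open>With b the ring element and m in level mu, each bracketing is moved to an action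
    on m itself: c(u(bm)) = c((ub)m) = (c(ub))m = ((cu)b)m = (cu)(bm). Here (f3) applies at every
    step, although bm is only known to lie in \<open>star N i\<close>.\<close>
  have "act N 0 (monomial K c \<one>) (act N i (monomial K \<one>\<^bsub>K\<^esub> u) (act N j b m)) =
      act N 0 (monomial K c \<one>) (act N \<mu> (monomial K \<one>\<^bsub>K\<^esub> u \<otimes>\<^bsub>KH\<^esub> b) m)"
    by (simp add: N.f3_assoc[OF FF j mon(2) b m])
  also have "\<dots> = act N \<mu> (monomial K c \<one> \<otimes>\<^bsub>KH\<^esub> (monomial K \<one>\<^bsub>K\<^esub> u \<otimes>\<^bsub>KH\<^esub> b)) m"
    by (rule N.f3_assoc[OF F0 order_refl mon(1) FF[OF mon(2) b] m])
  also have "\<dots> = act N \<mu> (monomial K c u \<otimes>\<^bsub>KH\<^esub> b) m"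
    using N.m_assoc[OF N.F_carrier[OF mon(1)] N.F_carrier[OF mon(2)] N.F_carrier[OF b]] c u
    by (simp add: monomial_mult)
  also have "\<dots> = act N i (monomial K c u) (act N j b m)"
    by (rule N.f3_assoc[OF FF j mon(3) b m, symmetric])
  finally show "act N 0 (monomial K c \<one>) (act N i (monomial K \<one>\<^bsub>K\<^esub> u) (act N j b m)) =
      act N i (monomial K c u) (act N j b m)" .
qed

text \<open>Additivity in the ring element comes from the scalars, that is from
  \<open>act N 0\<close>; additivity in the module element is inherited from both operations term by
  term. Agreement on levels and on products is supplied by the two preceding lemmas.\<close>

lemma fragment_expanded: "fragment KH FKH (N\<lparr>act := expanded_act\<rparr>)"
proof (rule N.fragment_act_replace)
  have act_u: "act N i (monomial K \<one>\<^bsub>K\<^esub> u) m \<in> star N 0" if "u \<in> HGs i" "m \<in> star N i" for i u m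
    using that by (intro N.carrier_star_zero N.act_closed monomial_FKH) auto
  show "expanded_act i a m \<in> carrier N" if a: "a \<in> FKH i" and m: "m \<in> star N i" for i a m
    unfolding expanded_act_def
    using scalar_act_closed[OF FKH_carrier[OF a] _ m] by (intro N.M.finsum_closed) auto
  show "expanded_act 0 a m \<in> star N i" if "a \<in> FKH 0" "m \<in> star N i" for i a m
  proof -
    \<comment> \<open>Level 0 is the whole carrier, so at index 0 the expanded action is the
      original one on all of \<open>star N i\<close>.\<close>
    have "m \<in> lev N 0" using that N.star_carrier by (simp add: N.lev_zero)
    then show ?thesis using that by (simp add: expanded_act_lev N.star_smult)
  qed
  show "expanded_act i (a \<oplus>\<^bsub>KH\<^esub> b) m = expanded_act i a m \<oplus>\<^bsub>N\<^esub> expanded_act i b m"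
    if a: "a \<in> FKH i" and b: "b \<in> FKH i" and m: "m \<in> star N i" for i a b m
  proof -
    have "expanded_act i (a \<oplus>\<^bsub>KH\<^esub> b) m =
        (\<Oplus>\<^bsub>N\<^esub>u\<in>HGs i. act N 0 (monomial K (a u) \<one>) (act N i (monomial K \<one>\<^bsub>K\<^esub> u) m) \<oplus>\<^bsub>N\<^esub>
          act N 0 (monomial K (b u) \<one>) (act N i (monomial K \<one>\<^bsub>K\<^esub> u) m))"
      unfolding expanded_act_def
      using FKH_carrier[OF a] FKH_carrier[OF b] scalar_act_closed[OF _ _ m]
      by (intro N.M.finsum_cong')
        (auto simp: KH_add[of a b] monomial_add N.act_add_left monomial_FKH_one act_u m)
    also have "\<dots> = expanded_act i a m \<oplus>\<^bsub>N\<^esub> expanded_act i b m"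
      unfolding expanded_act_def
      using scalar_act_closed[OF FKH_carrier[OF a] _ m] scalar_act_closed[OF FKH_carrier[OF b] _ m]
      by (intro N.M.finsum_addf) auto
    finally show ?thesis .
  qed
  show "expanded_act i a (m \<oplus>\<^bsub>N\<^esub> n) = expanded_act i a m \<oplus>\<^bsub>N\<^esub> expanded_act i a n"
    if a: "a \<in> FKH i" and m: "m \<in> star N i" and n: "n \<in> star N i" for i a m n
  proof -
    have "expanded_act i a (m \<oplus>\<^bsub>N\<^esub> n) =
        (\<Oplus>\<^bsub>N\<^esub>u\<in>HGs i. act N 0 (monomial K (a u) \<one>) (act N i (monomial K \<one>\<^bsub>K\<^esub> u) m) \<oplus>\<^bsub>N\<^esub>
          act N 0 (monomial K (a u) \<one>) (act N i (monomial K \<one>\<^bsub>K\<^esub> u) n))"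
      unfolding expanded_act_def
      using FKH_carrier[OF a] scalar_act_closed[OF _ _ m] scalar_act_closed[OF _ _ n]
      by (intro N.M.finsum_cong')
        (auto simp: N.act_add_right monomial_FKH_one monomial_FKH act_u m n)
    also have "\<dots> = expanded_act i a m \<oplus>\<^bsub>N\<^esub> expanded_act i a n"
      unfolding expanded_act_def
      using scalar_act_closed[OF FKH_carrier[OF a] _ m] scalar_act_closed[OF FKH_carrier[OF a] _ n]
      by (intro N.M.finsum_addf) auto
    finally show ?thesis .
  qed
  show "expanded_act i \<one>\<^bsub>KH\<^esub> m = m" if m: "m \<in> star N i" for i m
  proof -
    have one: "\<one> \<in> HGs i" using Gs_subgroup[of "min i d"] by (simp add: subgroup.one_closed)
    have "expanded_act i \<one>\<^bsub>KH\<^esub> m = (\<Oplus>\<^bsub>N\<^esub>u\<in>HGs i. if u = \<one> then m else \<zero>\<^bsub>N\<^esub>)"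
      unfolding expanded_act_def
    proof (rule N.M.finsum_cong')
      fix u assume u: "u \<in> HGs i"
      show "act N 0 (monomial K (\<one>\<^bsub>KH\<^esub> u) \<one>) (act N i (monomial K \<one>\<^bsub>K\<^esub> u) m) = (if u = \<one> then m else \<zero>\<^bsub>N\<^esub>)"
      proof (cases "u = \<one>")
        case True
        then have "\<one>\<^bsub>KH\<^esub> u = \<one>\<^bsub>K\<^esub>" by (simp add: KH_one monomial_def)
        then show ?thesis
          using True m N.star_carrier N.carrier_star_zero by (simp add: N.act_one flip: KH_one)
      next
        case False
        then have "\<one>\<^bsub>KH\<^esub> u = \<zero>\<^bsub>K\<^esub>" by (simp add: KH_one monomial_def)
        then show ?thesis
          using False act_u[OF u m] by (simp add: monomial_zero N.act_zero_left)
      qed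
    qed (use m N.star_carrier in auto)
    also have "\<dots> = m"
      using N.M.add.finprod_singleton_swap[OF one finite_HGs, of "\<lambda>_. m"] m N.star_carrier by auto
    finally show ?thesis .
  qed
next
  fix i j \<mu> a b m
  assume FF: "\<And>a b. a \<in> FKH i \<Longrightarrow> b \<in> FKH j \<Longrightarrow> a \<otimes>\<^bsub>KH\<^esub> b \<in> FKH \<mu>"
    and *: "j \<le> \<mu>" "a \<in> FKH i" "b \<in> FKH j" "m \<in> lev N \<mu>"
  show "expanded_act i a (act N j b m) = act N i a (act N j b m)"
    by (rule expanded_act_product[OF FF *])
qed (simp_all add: expanded_act_lev)

end

section \<open>Sections of the transversal and the elements through which cosets are acted
  on\<close>

locale induced_fragment_setup = normal_filtration_fragment K H G d Gs N
  for K :: "('k, 'x) ring_scheme" and H :: "'g set" and G :: "('g, 'y) monoid_scheme" (structure)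
    and d :: nat and Gs :: "nat \<Rightarrow> 'g set" and N :: "('g \<Rightarrow> 'k, 'm) fragment" +
  fixes T :: "nat \<Rightarrow> 'g set"
  assumes transversal: "ascending_transversal G H d Gs T"
    and filtered: "filtered_cocycle G H d Gs (T d)"
begin

abbreviation "Q \<equiv> carrier (G Mod H)"
abbreviation "\<sigma> \<equiv> coset_section (T d)"

lemma transversal_subset: "i \<le> d \<Longrightarrow> T i \<subseteq> T d"
proof (induction i rule: inc_induct)
  case (step i)
  then show ?case using transversal by (auto simp: ascending_transversal_def)
qed simp

lemma transversal_unique: "i \<le> d \<Longrightarrow> g \<in> Gs i \<Longrightarrow> \<exists>!t. t \<in> T i \<and> t \<in> g <# (H \<inter> Gs i)"
  using transversal unfolding ascending_transversal_def by blast

lemma section_eqI: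
  assumes "g \<in> carrier G" "t \<in> T d" "t \<in> H #> g"
  shows "\<sigma> (H #> g) = t"
proof -
  have "H #> g = g <# (H \<inter> Gs d)"
    using coset_eq assms(1) HGs_top by simp
  then have "\<exists>!t. t \<in> T d \<and> t \<in> H #> g"
    using transversal_unique[of d g] assms(1) Gs_top by simp
  then show ?thesis
    unfolding coset_section_def using assms(2,3) by (intro the1_equality) auto
qed

text \<open>This is where the transversal has to ascend: the representative of \<open>g\<close>
  taken from \<open>T i\<close> also lies in \<open>T d\<close>, hence is the one chosen by
  \<open>\<sigma>\<close>, and it differs from \<open>g\<close> by an element of H_i instead of
  merely of \<open>H\<close>.\<close>

lemma section_level:
  assumes i: "i \<le> d" and g: "g \<in> Gs i"
  shows "\<sigma> (H #> g) \<in> carrier G" "inv (\<sigma> (H #> g)) \<otimes> g \<in> H \<inter> Gs i"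
proof -
  have gG: "g \<in> carrier G" using subgroup.mem_carrier[OF Gs_subgroup[OF i] g] .
  interpret HGi: normal "H \<inter> Gs i" G by (rule HGs_normal[OF i])
  obtain t where t: "t \<in> T i" "t \<in> g <# (H \<inter> Gs i)"
    using transversal_unique[OF i g] by blast
  then obtain h where h: "h \<in> H \<inter> Gs i" "t = g \<otimes> h"
    by (auto simp: l_coset_def)
  have "t \<in> g <# H" using h by (auto simp: l_coset_def)
  then have "\<sigma> (H #> g) = t"
    using transversal_subset[OF i] t gG coset_eq by (intro section_eqI) auto
  then show "\<sigma> (H #> g) \<in> carrier G" "inv (\<sigma> (H #> g)) \<otimes> g \<in> H \<inter> Gs i"
    using h gG HGi.mem_carrier[OF h(1)] HGi.m_inv_closed[OF h(1)]
    by (simp_all add: inv_mult_group m_assoc)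
qed

lemma cosetE:
  assumes "c \<in> Q"
  obtains g where "g \<in> carrier G" "c = H #> g"
  using assms by (auto simp: carrier_FactGroup)

lemma section_carrier: "c \<in> Q \<Longrightarrow> \<sigma> c \<in> carrier G"
  using section_level(1)[of d] Gs_top by (auto elim: cosetE)

lemma section_H: "\<sigma> H = \<one>"
proof -
  have "\<one> \<in> T d"
    using transversal transversal_subset[of 0] by (auto simp: ascending_transversal_def)
  then have "\<sigma> (H #> \<one>) = \<one>"
    by (intro section_eqI rcos_self subgroup_axioms) auto
  then show ?thesis using subset by simp
qed

lemma H_mult_coset: "c \<in> Q \<Longrightarrow> H <#> c = c"
  using rcosets_mult_eq by (simp add: FactGroup_def)

lemma cocycle_H: "c \<in> Q \<Longrightarrow> cocycle G H (T d) H c = \<one>"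
  using section_carrier by (simp add: cocycle_def section_H H_mult_coset)

lemma finite_Q: "finite Q"
  using finite_G by (simp add: carrier_FactGroup)

text \<open>The element of \<open>H\<close> through which \<open>g\<close> acts on \<open>K c \<otimes> N\<close>.\<close>

definition local_factor :: "'g \<Rightarrow> 'g set \<Rightarrow> 'g" where
  "local_factor g c = cocycle G H (T d) (H #> g) c \<otimes>
     (inv (\<sigma> c) \<otimes> (inv (\<sigma> (H #> g)) \<otimes> g) \<otimes> \<sigma> c)"

text \<open>The first factor is controlled by the filtered cocycle; the second is a conjugate of an
  element of H_j, which is normal in \<open>G\<close>.\<close>

lemma local_factor_level:
  assumes g: "g \<in> Gs (min j d)" and c: "c \<in> Q"
  shows "local_factor g c \<in> HGs j"
proof -
  interpret HGj: normal "HGs j" G by (rule HGs_normal) simp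
  obtain x where "x \<in> carrier G" "c = H #> x" using c by (rule cosetE)
  then have "cocycle G H (T d) (H #> g) c \<in> HGs j"
    using filtered g min.cobounded2[of j d] unfolding filtered_cocycle_def by blast
  moreover have "inv (\<sigma> c) \<otimes> (inv (\<sigma> (H #> g)) \<otimes> g) \<otimes> \<sigma> c \<in> HGs j"
    using section_level(2)[of "min j d", OF _ g] section_carrier[OF c] HGj.inv_op_closed1 by auto
  ultimately show ?thesis
    unfolding local_factor_def by (rule HGj.m_closed)
qed

lemma local_factor_H:
  assumes h: "h \<in> H" and c: "c \<in> Q"
  shows "local_factor h c = inv (\<sigma> c) \<otimes> h \<otimes> \<sigma> c"
  using h c section_carrier[OF c] mem_carrier[OF h] rcos_const[OF group_axioms h]
  by (simp add: local_factor_def cocycle_H section_H)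

lemma abelian_group_tensor: "abelian_group (coset_tensor G H N)"
proof -
  have "abelian_group (product_fragment Q (\<lambda>_. N))"
    using fragment_product[OF N.filtered_ring_axioms N.fragment_axioms, of Q]
    by (simp add: fragment_def)
  from abelian_groupE[OF this] show ?thesis
    by (intro abelian_groupI) (simp_all add: coset_tensor_def)
qed

lemma finsum_tensor_apply:
  assumes "f \<in> I \<rightarrow> carrier (coset_tensor G H N)" "c \<in> Q"
  shows "finsum (coset_tensor G H N) f I c = (\<Oplus>\<^bsub>N\<^esub>i\<in>I. f i c)"
  using assms
  by (intro additive_map_finsum[OF abelian_group_tensor N.M.abelian_group_axioms, of "\<lambda>m. m c"])
    (auto simp: coset_tensor_def)

section \<open>The induced action in coordinates\<close>

abbreviation "act_ind \<equiv> induced_act K G H d Gs (T d) N"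

text \<open>Terms with g outside \<open>H\<close> have coefficient zero. An element g of
  \<open>H\<close> fixes every coset, so at the coordinate c only the summand of c itself
  contributes, and reindexing by conjugation turns what remains into the expanded action.\<close>

lemma induced_act_eq:
  assumes a: "a \<in> FKH j" and m: "m \<in> (\<Pi>\<^sub>E c\<in>Q. star N j)"
  shows "act_ind j a m = (\<lambda>c\<in>Q. expanded_act j (conj_twist (\<sigma> c) a) (m c))"
proof -
  let ?A = "coset_tensor G H N"
  interpret A: abelian_group ?A by (rule abelian_group_tensor)
  define v where
    "v g c = act N 0 (monomial K (a g) \<one>) (act N j (monomial K \<one>\<^bsub>K\<^esub> (local_factor g c)) (m c))" for g c
  define p where "p g c = pure_tensor G H N ((H #> g) <#> c) (v g c)" for g c
  have v: "v g c \<in> carrier N" if "g \<in> Gs (min j d)" "c \<in> Q" for g c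
    unfolding v_def using that m
    by (intro scalar_act_closed FKH_carrier[OF a] local_factor_level) auto
  \<comment> \<open>The zero scalar annihilates elements of the carrier only, so the inner action
    has to be well placed even though its coefficient is zero.\<close>
  have v_zero: "v g c = \<zero>\<^bsub>N\<^esub>" if "g \<in> Gs (min j d)" "g \<notin> H" "c \<in> Q" for g c
  proof -
    have "a g = \<zero>\<^bsub>K\<^esub>" using a that by (simp add: FKH_iff)
    moreover have "act N j (monomial K \<one>\<^bsub>K\<^esub> (local_factor g c)) (m c) \<in> carrier N"
      using that m by (intro N.act_closed monomial_FKH local_factor_level) auto
    ultimately show ?thesis
      by (simp add: v_def monomial_zero N.act_zero_left N.carrier_star_zero)
  qed
  have p: "p g c \<in> carrier ?A" if "g \<in> Gs (min j d)" "c \<in> Q" for g c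
    using v[OF that] by (auto simp: p_def pure_tensor_def coset_tensor_def)
  have G_min: "(if j \<le> d then Gs j else carrier G) = Gs (min j d)"
    using Gs_top by (simp add: min_def)
  have sum: "act_ind j a m = (\<Oplus>\<^bsub>?A\<^esub>g\<in>Gs (min j d). \<Oplus>\<^bsub>?A\<^esub>c\<in>Q. p g c)"
    unfolding induced_act_def G_min by (simp add: Let_def p_def v_def local_factor_def)
  have inner: "(\<lambda>g. \<Oplus>\<^bsub>?A\<^esub>c\<in>Q. p g c) \<in> Gs (min j d) \<rightarrow> carrier ?A"
    using p by (auto intro: A.finsum_closed)
  show ?thesis
  proof
    fix c
    show "act_ind j a m c = (\<lambda>c\<in>Q. expanded_act j (conj_twist (\<sigma> c) a) (m c)) c"
    proof (cases "c \<in> Q")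
      \<comment> \<open>Off \<open>Q\<close> both sides take the default value
        \<open>undefined\<close>, by extensionality.\<close>
      case False
      have "act_ind j a m \<in> carrier ?A"
        unfolding sum using inner by (rule A.finsum_closed)
      then show ?thesis using False by (auto simp: coset_tensor_def)
    next
      case c: True
      let ?t = "\<sigma> c" and ?h = "\<lambda>x. \<sigma> c \<otimes> x \<otimes> inv (\<sigma> c)"
      have t: "?t \<in> carrier G" by (rule section_carrier[OF c])
      have "HGs j \<lhd> G" by (rule HGs_normal) simp
      note bij = bij_betw_conjugation[OF this t]
      have "act_ind j a m c = (\<Oplus>\<^bsub>N\<^esub>g\<in>Gs (min j d). (\<Oplus>\<^bsub>?A\<^esub>c'\<in>Q. p g c') c)"
        unfolding sum using inner c by (rule finsum_tensor_apply)
      also have "\<dots> = (\<Oplus>\<^bsub>N\<^esub>g\<in>Gs (min j d). if g \<in> H then v g c else \<zero>\<^bsub>N\<^esub>)"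
      proof (rule N.M.finsum_cong')
        fix g assume g: "g \<in> Gs (min j d)"
        have "(\<Oplus>\<^bsub>?A\<^esub>c'\<in>Q. p g c') c = (\<Oplus>\<^bsub>N\<^esub>c'\<in>Q. p g c' c)"
          using p[OF g] c by (intro finsum_tensor_apply) auto
        also have "\<dots> = (if g \<in> H then v g c else \<zero>\<^bsub>N\<^esub>)"
        proof (cases "g \<in> H")
          case True
          have "(\<Oplus>\<^bsub>N\<^esub>c'\<in>Q. p g c' c) = (\<Oplus>\<^bsub>N\<^esub>c'\<in>Q. if c = c' then v g c' else \<zero>\<^bsub>N\<^esub>)"
            using v[OF g] c rcos_const[OF group_axioms True]
            by (intro N.M.finsum_cong') (auto simp: p_def pure_tensor_def H_mult_coset)
          then show ?thesis
            using True v[OF g] N.M.finsum_singleton[OF c finite_Q, of "v g"] by auto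
        next
          case False
          then have "(\<Oplus>\<^bsub>N\<^esub>c'\<in>Q. p g c' c) = \<zero>\<^bsub>N\<^esub>"
            using c v_zero[OF g False]
            by (intro N.M.add.finprod_one_eqI) (auto simp: p_def pure_tensor_def)
          then show ?thesis using False by simp
        qed
        finally show "(\<Oplus>\<^bsub>?A\<^esub>c'\<in>Q. p g c') c = (if g \<in> H then v g c else \<zero>\<^bsub>N\<^esub>)" .
      qed (use v c in auto)
      also have "\<dots> = (\<Oplus>\<^bsub>N\<^esub>g\<in>HGs j. v g c)"
      proof (rule N.M.add.finprod_mono_neutral_cong_right)
        show "finite (Gs (min j d))"
          using finite_subset[OF subgroup.subset[OF Gs_subgroup] finite_G] by simp
      qed (use v c in auto)
      \<comment> \<open>With g = t x t^-1 the local factor t^-1 g t becomes x, and the coefficient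
        of \<open>a\<close> at g becomes that of its twist at x.\<close>
      also have "\<dots> = (\<Oplus>\<^bsub>N\<^esub>g\<in>?h ` HGs j. v g c)"
        by (simp only: bij_betw_imp_surj_on[OF bij])
      also have "\<dots> = (\<Oplus>\<^bsub>N\<^esub>x\<in>HGs j. v (?h x) c)"
        using v c bij_betw_imp_surj_on[OF bij] bij_betw_imp_inj_on[OF bij]
        by (intro N.M.finsum_reindex) auto
      also have "\<dots> = expanded_act j (conj_twist ?t a) (m c)"
        unfolding expanded_act_def
      proof (rule N.M.finsum_cong')
        fix x assume x: "x \<in> HGs j"
        have "?h x \<in> H" using x t inv_op_closed2 by auto
        then have "local_factor (?h x) c = inv ?t \<otimes> ?h x \<otimes> ?t"
          using c by (rule local_factor_H)
        also have "\<dots> = x"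
          using t x mem_carrier by (simp add: m_assoc) (simp flip: m_assoc)
        finally show "v (?h x) c = act N 0 (monomial K (conj_twist ?t a x) \<one>)
            (act N j (monomial K \<one>\<^bsub>K\<^esub> x) (m c))"
          using x by (simp add: v_def conj_twist_def)
      next
        have "conj_twist ?t a \<in> FKH j"
          using conj_twist_endo[OF t] a by (auto simp: filtered_endo_def)
        then show "(\<lambda>x. act N 0 (monomial K (conj_twist ?t a x) \<one>) (act N j (monomial K \<one>\<^bsub>K\<^esub> x) (m c)))
            \<in> HGs j \<rightarrow> carrier N"
          using m c by (intro Pi_I scalar_act_closed FKH_carrier) auto
      qed simp
      finally show ?thesis using c by simp
    qed
  qed
qed

abbreviation "M \<equiv> induced_fragment K G H d Gs (T d) N"

lemma induced_fragment_simps [simp]: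
  "carrier M = (\<Pi>\<^sub>E c\<in>Q. carrier N)" "\<zero>\<^bsub>M\<^esub> = (\<lambda>c\<in>Q. \<zero>\<^bsub>N\<^esub>)"
  "x \<oplus>\<^bsub>M\<^esub> y = (\<lambda>c\<in>Q. x c \<oplus>\<^bsub>N\<^esub> y c)" "lev M i = (\<Pi>\<^sub>E c\<in>Q. lev N i)"
  "star M i = (\<Pi>\<^sub>E c\<in>Q. star N i)" "act M = act_ind"
  by (simp_all add: induced_fragment_def coset_tensor_def ring.extend_def fragment.fields_def)

text \<open>The copies in this product carry the expanded action. Transport along the identity
  changes nothing but the scalars, and afterwards only the action field has to be exchanged for
  \<open>act_ind\<close>, which agrees with that of the product on \<open>star\<close>.\<close>

lemma fragment_induced: "fragment KH FKH M"
proof -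
  let ?N = "N\<lparr>act := expanded_act\<rparr>"
  let ?P = "product_fragment Q (\<lambda>c. transport_fragment (conj_twist (\<sigma> c)) id id ?N)"
  interpret P: fragment KH FKH ?P
  proof (rule fragment_product[OF N.filtered_ring_axioms])
    fix c assume "c \<in> Q"
    then show "fragment KH FKH (transport_fragment (conj_twist (\<sigma> c)) id id ?N)"
      by (intro fragment.fragment_transport[OF fragment_expanded] conj_twist_endo section_carrier) simp_all
  qed
  have "M = ?P\<lparr>act := act_ind\<rparr>"
    by (simp add: induced_fragment_def coset_tensor_def ring.extend_def fragment.fields_def
        product_fragment_def)
  moreover have "fragment KH FKH (?P\<lparr>act := act_ind\<rparr>)"
    by (rule P.fragment_act_cong) (simp add: induced_act_eq)
  ultimately show ?thesis by simp
qed

section \<open>The summands and their direct sum\<close>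

definition summand :: "'g set \<Rightarrow> ('g \<Rightarrow> 'k, 'g set \<Rightarrow> 'm) fragment" where
  "summand c = transport_fragment (conj_twist (\<sigma> c)) (pure_tensor G H N c) (\<lambda>m. m c) N"

lemma pure_tensor_same: "c \<in> Q \<Longrightarrow> pure_tensor G H N c x c = x"
  by (simp add: pure_tensor_def)

lemma pure_tensor_closed: "x \<in> lev N i \<Longrightarrow> pure_tensor G H N c x \<in> lev M i"
  using N.zero_in_lev by (auto simp: pure_tensor_def)

lemma pure_tensor_zero: "pure_tensor G H N c \<zero>\<^bsub>N\<^esub> = \<zero>\<^bsub>M\<^esub>"
  by (auto simp: pure_tensor_def)

lemma fragment_summand: "c \<in> Q \<Longrightarrow> fragment KH FKH (summand c)"
  unfolding summand_def
  by (intro N.fragment_transport conj_twist_endo section_carrier pure_tensor_same)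

text \<open>\<open>summand c\<close> uses the action of \<open>N\<close>, \<open>M\<close> the
  expanded one. They are compared on levels only, where the two coincide.\<close>

lemma subfragment_summand:
  assumes c: "c \<in> Q"
  shows "subfragment KH FKH (summand c) M"
  unfolding subfragment_def
proof (intro conjI allI ballI fragment_induced fragment_summand c)
  show "\<zero>\<^bsub>summand c\<^esub> = \<zero>\<^bsub>M\<^esub>"
    by (simp only: summand_def transport_fragment_simps pure_tensor_zero)
  show "lev (summand c) i \<subseteq> lev M i" for i
    using pure_tensor_closed by (auto simp: summand_def)
  show "x \<oplus>\<^bsub>summand c\<^esub> y = x \<oplus>\<^bsub>M\<^esub> y"
    if "x \<in> carrier (summand c)" "y \<in> carrier (summand c)" for x y
    using that c by (auto simp: summand_def pure_tensor_def intro!: restrict_ext)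
  show "act (summand c) i a n = act M i a n" if a: "a \<in> FKH i" and n: "n \<in> lev (summand c) i" for i a n
  proof -
    obtain x where x: "x \<in> lev N i" "n = pure_tensor G H N c x"
      using n by (auto simp: summand_def)
    have tw: "conj_twist (\<sigma> c') a \<in> FKH i" if "c' \<in> Q" for c'
      using conj_twist_endo[OF section_carrier[OF that]] a by (auto simp: filtered_endo_def)
    have "n \<in> (\<Pi>\<^sub>E c\<in>Q. star N i)"
      using pure_tensor_closed[OF x(1)] N.lev_star x(2) by (auto simp: PiE_iff)
    then have "act M i a n = (\<lambda>c'\<in>Q. expanded_act i (conj_twist (\<sigma> c') a) (n c'))"
      using induced_act_eq[OF a] by simp
    \<comment> \<open>At cosets other than c the coordinate of \<open>n\<close> is zero and is sent
      to zero.\<close>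
    also have "\<dots> = pure_tensor G H N c (act N i (conj_twist (\<sigma> c) a) x)"
      unfolding pure_tensor_def x(2)
      using x(1) tw N.zero_in_lev by (intro restrict_ext) (simp add: expanded_act_lev N.act_zero_right)
    finally show ?thesis
      using x c by (simp add: summand_def pure_tensor_same)
  qed
qed

lemma irreducible_summand:
  assumes "irreducible_fragment KH FKH N" and c: "c \<in> Q"
  shows "irreducible_fragment KH FKH (summand c)"
  unfolding summand_def
proof (rule irreducible_transport[OF assms(1)])
  have t: "\<sigma> c \<in> carrier G" by (rule section_carrier[OF c])
  show "filtered_endo KH FKH (conj_twist (\<sigma> c))" "filtered_endo KH FKH (conj_twist (inv (\<sigma> c)))"
    using t by (auto intro: conj_twist_endo)
  show "conj_twist (\<sigma> c) (conj_twist (inv (\<sigma> c)) a) = a" if "a \<in> FKH i" for i a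
    by (rule conj_twist_inverse[OF t that])
qed (rule pure_tensor_same[OF c])

lemma essential_length_summand:
  "c \<in> Q \<Longrightarrow> essential_length (summand c) e \<longleftrightarrow> essential_length N e"
  unfolding summand_def by (intro N.essential_length_transport pure_tensor_same)

text \<open>Each coordinate c receives a contribution from exactly one index, the one numbering c.
  The enumeration \<open>b\<close> is carried along because the summands are finally to be indexed
  by numbers below the index of \<open>H\<close>.\<close>

lemma finsum_pure_tensor:
  assumes b: "bij_betw b I Q" and y: "y \<in> I \<rightarrow> carrier N"
  shows "(\<Oplus>\<^bsub>M\<^esub>k\<in>I. pure_tensor G H N (b k) (y k)) = (\<lambda>c\<in>Q. y (inv_into I b c))"
    (is "?s = _")
proof
  interpret M: fragment KH FKH M by (rule fragment_induced)
  have p: "(\<lambda>k. pure_tensor G H N (b k) (y k)) \<in> I \<rightarrow> carrier M"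
    using y by (auto simp: pure_tensor_def)
  have finI: "finite I" using b finite_Q bij_betw_finite by blast
  fix c
  show "?s c = (\<lambda>c\<in>Q. y (inv_into I b c)) c"
  proof (cases "c \<in> Q")
    case False
    have "?s \<in> carrier M" using p by (rule M.M.finsum_closed)
    then show ?thesis using False by auto
  next
    case c: True
    let ?k = "inv_into I b c"
    have k: "?k \<in> I" "b k = c \<longleftrightarrow> ?k = k" if "k \<in> I" for k
      using b c that by (auto simp: bij_betw_def f_inv_into_f inv_into_into)
    have k0: "?k \<in> I" using b c by (auto simp: bij_betw_def inv_into_into)
    have "?s c = (\<Oplus>\<^bsub>N\<^esub>k\<in>I. pure_tensor G H N (b k) (y k) c)"
      using p c by (intro additive_map_finsum[of M N "\<lambda>m. m c"] M.M.abelian_group_axioms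
          N.M.abelian_group_axioms) auto
    also have "\<dots> = (\<Oplus>\<^bsub>N\<^esub>k\<in>I. if ?k = k then y k else \<zero>\<^bsub>N\<^esub>)"
      using y c k(2) by (intro N.M.finsum_cong') (auto simp: pure_tensor_def)
    also have "\<dots> = y ?k"
      using k0 finI y by (rule N.M.finsum_singleton)
    finally show ?thesis using c by simp
  qed
qed

lemma fragment_direct_sum_summand:
  assumes b: "bij_betw b I Q" and e: "essential_length N e"
  shows "fragment_direct_sum M I (\<lambda>k. summand (b k))"
proof -
  have bQ: "b k \<in> Q" if "k \<in> I" for k using b that by (auto simp: bij_betw_def)
  have inv: "inv_into I b c \<in> I" "b (inv_into I b c) = c" if "c \<in> Q" for c
    using b that by (auto simp: bij_betw_def inv_into_into f_inv_into_f)
  have inv': "inv_into I b (b k) = k" if "k \<in> I" for k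
    using b that by (auto simp: bij_betw_def)
  interpret M: fragment KH FKH M by (rule fragment_induced)
  \<comment> \<open>A sum of elements of the summands merely lists their coordinates y. This one
    fact gives both the inclusion of the levelwise sum in \<open>lev M i\<close> and the
    directness.\<close>
  have sum: "\<exists>y \<in> I \<rightarrow> lev N i. (\<forall>k\<in>I. x k = pure_tensor G H N (b k) (y k)) \<and>
      (\<Oplus>\<^bsub>M\<^esub>k\<in>I. x k) = (\<lambda>c\<in>Q. y (inv_into I b c))"
    if x: "\<forall>k\<in>I. x k \<in> lev (summand (b k)) i" for x i
  proof -
    have "\<forall>k\<in>I. \<exists>y. y \<in> lev N i \<and> x k = pure_tensor G H N (b k) y"
      using x by (auto simp: summand_def)
    then obtain y where y: "\<forall>k\<in>I. y k \<in> lev N i \<and> x k = pure_tensor G H N (b k) (y k)"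
      by (auto simp: bchoice_iff)
    have "(\<lambda>k. pure_tensor G H N (b k) (y k)) \<in> I \<rightarrow> carrier M"
      using y M.lev_carrier[OF pure_tensor_closed] by blast
    then have "(\<Oplus>\<^bsub>M\<^esub>k\<in>I. x k) = (\<Oplus>\<^bsub>M\<^esub>k\<in>I. pure_tensor G H N (b k) (y k))"
      using y by (intro M.M.finsum_cong') simp_all
    also have "\<dots> = (\<lambda>c\<in>Q. y (inv_into I b c))"
      using y N.lev_carrier by (intro finsum_pure_tensor[OF b]) auto
    finally show ?thesis using y by (intro bexI[of _ y]) auto
  qed
  show ?thesis
    unfolding fragment_direct_sum_def
  proof (intro conjI allI exI[of _ 0])
    show "lev M i = {(\<Oplus>\<^bsub>M\<^esub>k\<in>I. x k) |x. \<forall>k\<in>I. x k \<in> lev (summand (b k)) i}" (is "_ = ?S") for i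
    proof (intro equalityI subsetI)
      fix m assume m: "m \<in> lev M i"
      have "(\<Oplus>\<^bsub>M\<^esub>k\<in>I. pure_tensor G H N (b k) (m (b k))) = (\<lambda>c\<in>Q. m (b (inv_into I b c)))"
        using m bQ N.lev_carrier by (intro finsum_pure_tensor[OF b]) auto
      also have "\<dots> = m"
        using m by (auto simp: inv PiE_iff extensional_def fun_eq_iff)
      finally show "m \<in> ?S"
        using m bQ by (auto simp: summand_def intro!: exI[of _ "\<lambda>k. pure_tensor G H N (b k) (m (b k))"])
    next
      fix m assume "m \<in> ?S"
      then obtain x where "\<forall>k\<in>I. x k \<in> lev (summand (b k)) i" "m = (\<Oplus>\<^bsub>M\<^esub>k\<in>I. x k)" by auto
      with sum obtain y where "y \<in> I \<rightarrow> lev N i" "m = (\<lambda>c\<in>Q. y (inv_into I b c))" by metis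
      then show "m \<in> lev M i" using inv by auto
    qed
    show "\<forall>k\<in>I. \<exists>e. essential_length (summand (b k)) e \<and> 0 \<le> e"
      using e bQ by (auto simp: essential_length_summand)
    show "(\<forall>k\<in>I. x k \<in> lev (summand (b k)) 0) \<and> (\<Oplus>\<^bsub>M\<^esub>k\<in>I. x k) = \<zero>\<^bsub>M\<^esub> \<longrightarrow>
        (\<forall>k\<in>I. x k = \<zero>\<^bsub>M\<^esub>)" for x
    proof (intro impI ballI, elim conjE)
      fix k assume x: "\<forall>k\<in>I. x k \<in> lev (summand (b k)) 0" and zero: "(\<Oplus>\<^bsub>M\<^esub>k\<in>I. x k) = \<zero>\<^bsub>M\<^esub>"
        and k: "k \<in> I"
      obtain y where y: "\<forall>k\<in>I. x k = pure_tensor G H N (b k) (y k)"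
        "(\<Oplus>\<^bsub>M\<^esub>k\<in>I. x k) = (\<lambda>c\<in>Q. y (inv_into I b c))"
        using sum[OF x] by auto
      \<comment> \<open>Read off at the coset \<open>b k\<close>, the vanishing sum shows y k
        alone.\<close>
      have "y k = \<zero>\<^bsub>N\<^esub>"
        using fun_cong[OF trans[OF y(2)[symmetric] zero], of "b k"] bQ[OF k] inv'[OF k] by simp
      then show "x k = \<zero>\<^bsub>M\<^esub>" using y(1) k pure_tensor_zero by simp
    qed
  qed
qed

end

theorem theorem4p1:
  fixes K :: "('k, 'x) ring_scheme"
    and G :: "('g, 'y) monoid_scheme"
    and H :: "'g set"
    and d :: nat
    and Gs T :: "nat \<Rightarrow> 'g set"
    and N :: "('g \<Rightarrow> 'k, 'm) fragment"
  defines "KH \<equiv> group_algebra K (G\<lparr>carrier := H\<rparr>)"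
    and "FKH \<equiv> group_filtration K (G\<lparr>carrier := H\<rparr>) d (\<lambda>i. H \<inter> Gs i)"
    and "M \<equiv> induced_fragment K G H d Gs (T d) N"
    and "index \<equiv> card (rcosets\<^bsub>G\<^esub> H)"
  assumes "field K"
    and "\<forall>n::nat. 0 < n \<longrightarrow> [n] \<cdot>\<^bsub>K\<^esub> \<one>\<^bsub>K\<^esub> \<noteq> \<zero>\<^bsub>K\<^esub>"
    and "group G" and "finite (carrier G)"
    and "Gs 0 = {\<one>\<^bsub>G\<^esub>}" and "Gs d = carrier G"
    and "\<forall>i \<le> d. subgroup (Gs i) G"
    and "\<forall>i < d. Gs i \<lhd> (G\<lparr>carrier := Gs (Suc i)\<rparr>)"
    and "H \<lhd> G"
    and "\<forall>i \<le> d. (H \<inter> Gs i) \<lhd> G"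
    and "ascending_transversal G H d Gs T"
    and "filtered_cocycle G H d Gs (T d)"
    and "irreducible_fragment KH FKH N"
    and "essential_length N d"
    and "body N = {\<zero>\<^bsub>N\<^esub>}"
  shows "\<exists>E :: nat \<Rightarrow> ('g \<Rightarrow> 'k, 'g set \<Rightarrow> 'm) fragment.
           (\<forall>k < index. subfragment KH FKH (E k) M \<and>
              irreducible_fragment KH FKH (E k) \<and> essential_length (E k) d) \<and>
           fragment_direct_sum M {..<index} E"
proof -
  have N: "fragment KH FKH N" using assms by (simp add: irreducible_fragment_def)
  interpret induced_fragment_setup K H G d Gs N T
    by (intro induced_fragment_setup.intro normal_filtration_fragment.intro normal_filtration.intro
        normal_filtration_axioms.intro induced_fragment_setup_axioms.intro N[unfolded KH_def FKH_def])
      (use assms in auto)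
  obtain b where b: "bij_betw b {..<index} (carrier (G Mod H))"
    using ex_bij_betw_nat_finite[OF finite_Q]
    by (auto simp: index_def FactGroup_def atLeast0LessThan)
  then have "b k \<in> carrier (G Mod H)" if "k < index" for k
    using that by (auto simp: bij_betw_def)
  \<comment> \<open>\<open>assms(17,18)\<close> are the irreducibility and the essential length of
    \<open>N\<close>; the four \<open>defines\<close> are counted first.\<close>
  then show ?thesis
    using subfragment_summand irreducible_summand essential_length_summand
      fragment_direct_sum_summand[OF b] assms(17,18)
    unfolding KH_def FKH_def M_def by (intro exI[of _ "\<lambda>k. summand (b k)"]) auto
qed

end
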